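(* Consider the finite-horizon zero-sum two-team stochastic dynamic game described in the context, with causal information structures $\mathcal S_1,\mathcal S_2$ that are mutually quadratically invariant under $[\,\mathcal P_{12}\ \ \mathcal P_{13}\,]$, and assume $$\begin{bmatrix}\mathcal P_{12}^\top\mathcal M\mathcal P_{12}+\mathcal R & \mathcal P_{12}^\top\mathcal M\mathcal P_{13}\\ \mathcal P_{13}^\top\mathcal M\mathcal P_{12} & -\left(\mathcal P_{13}^\top\mathcal M\mathcal P_{13}+\mathcal V\right)\end{bmatrix}\succ0 .$$ Let $(\bar{\mathcal Q}_1,\bar{\mathcal Q}_2)\in\mathcal S_1\times\mathcal S_2$ be the unique saddle point equilibrium in the (structured, linear) disturbance feedforward strategies. Then, if there exists a saddle point equilibrium in the (structured, linear) state feedback strategies, it is unique and is given by $$\begin{bmatrix}\bar{\mathcal K}_1\\ \bar{\mathcal K}_2\end{bmatrix}=g\left(\begin{bmatrix}\bar{\mathcal Q}_1\\ \bar{\mathcal Q}_2\end{bmatrix}\right).$$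
   Context: **System.** Fix positive integers $n,m_1,m_2,N$ and matrices $A\in\mathbb R^{n\times n}$, $B_1\in\mathbb R^{n\times m_1}$, $B_2\in\mathbb R^{n\times m_2}$. The dynamics are $x(t+1)=Ax(t)+B_1u(t)+B_2v(t)+w(t)$, $t=0,\dots,N-1$. Write $\mathbf x=(x(0),\dots,x(N))\in\mathbb R^{n(N+1)}$, $\mathbf u=(u(0),\dots,u(N-1))\in\mathbb R^{m_1N}$, $\mathbf v=(v(0),\dots,v(N-1))\in\mathbb R^{m_2N}$, $\mathbf w=(x(0),w(0),\dots,w(N-1))\in\mathbb R^{n(N+1)}$. The vector $\mathbf w$ is Gaussian with mean zero and covariance $\Sigma_{\mathbf w}\succ0$. Let $\mathcal A=\mathrm{blockdiag}(A,\dots,A)\in\mathbb R^{n(N+1)\times n(N+1)}$. For $i=1,2$ let $\mathcal B_i\in\mathbb R^{n(N+1)\times m_iN}$ be $\mathrm{blockdiag}(B_i,\dots,B_i)$ ($N$ blocks) with $n$ zero rows appended at the bottom. Let $\mathcal Z\in\mathbb R^{n(N+1)\times n(N+1)}$ be the block shift matrix, with $n\times n$ identity blocks on the first block subdiagonal and zeros elsewhere. Then $\mathbf x=\mathcal P_{11}\mathbf w+\mathcal P_{12}\mathbf u+\mathcal P_{13}\mathbf v$, where $\mathcal P_{11}=(I-\mathcal Z\mathcal A)^{-1}$, $\mathcal P_{12}=(I-\mathcal Z\mathcal A)^{-1}\mathcal Z\mathcal B_1$, $\mathcal P_{13}=(I-\mathcal Z\mathcal A)^{-1}\mathcal Z\mathcal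 B_2$. **Cost.** Let $\mathcal M=\mathrm{blockdiag}(0,M(1),\dots,M(N))$, $\mathcal R=\mathrm{blockdiag}(R(0),\dots,R(N-1))$, $\mathcal V=\mathrm{blockdiag}(V(0),\dots,V(N-1))$, with symmetric blocks $M(t)\in\mathbb R^{n\times n}$, $R(t)\in\mathbb R^{m_1\times m_1}$, $V(t)\in\mathbb R^{m_2\times m_2}$. In the zero-sum game, team 1 chooses $\mathbf u$ to minimize, and team 2 chooses $\mathbf v$ to maximize, $\mathbf J(\mathbf u,\mathbf v)=\mathbb E\left(\mathbf x^\top\mathcal M\mathbf x+\mathbf u^\top\mathcal R\mathbf u+\mathbf v^\top\mathcal V\mathbf v\right)$. **Information structures.** Each $\mathcal S_i$ is a binary matrix in $\{0,1\}^{m_iN\times n(N+1)}$. For a matrix $\mathcal K_i\in\mathbb R^{m_iN\times n(N+1)}$, $\mathcal K_i\in\mathcal S_i$ means that $[\mathcal K_i]_{jk}=0$ whenever $[\mathcal S_i]_{jk}=0$; thus $\mathcal S_i$ is identified with a linear subspace of matrices. The structures are causal: the block of $\mathcal K_i\in\mathcal S_i$ that multiplies $x(s)$ in the input at time $t$ is zero whenever $s>t$. For stacked matrices, $\begin{bmatrix}\mathcal K_1\\ \mathcal K_2\end{bmatrix}\in\mathcal S_1\times\mathcal S_2$ means $\mathcal K_1\in\mathcal S_1$ and $\mathcal K_2\in\mathcal S_2$. **Strategies and the map $g$.** A pair $(\mathcal Q_1,\mathcal Q_2)\in\mathcal S_1\times\mathcal S_2$ represents linear disturbance feedforward strategies $\mathbf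 u=\mathcal Q_1\mathcal P_{11}\mathbf w$, $\mathbf v=\mathcal Q_2\mathcal P_{11}\mathbf w$, with cost $\mathcal J\left(\begin{bmatrix}\mathcal Q_1\\ \mathcal Q_2\end{bmatrix}\right)=\mathbf J(\mathcal Q_1\mathcal P_{11}\mathbf w,\mathcal Q_2\mathcal P_{11}\mathbf w)$. A pair $(\mathcal K_1,\mathcal K_2)\in\mathcal S_1\times\mathcal S_2$ represents linear state feedback strategies $\mathbf u=\mathcal K_1\mathbf x$, $\mathbf v=\mathcal K_2\mathbf x$. With $\mathcal Q=\begin{bmatrix}\mathcal Q_1\\ \mathcal Q_2\end{bmatrix}$, $\mathcal K=\begin{bmatrix}\mathcal K_1\\ \mathcal K_2\end{bmatrix}$, $\mathcal P=[\,\mathcal P_{12}\ \ \mathcal P_{13}\,]$, define $$g(\mathcal Q)=(I+\mathcal Q\mathcal P)^{-1}\mathcal Q,\qquad g^{-1}(\mathcal K)=\mathcal K(I-\mathcal P\mathcal K)^{-1}$$ (the inverses exist for causal $\mathcal Q$, $\mathcal K$). The cost under feedback $\mathcal K$ is $\mathcal J(g^{-1}(\mathcal K))$. **Mutual quadratic invariance (MQI).** $\mathcal S_1,\mathcal S_2$ are mutually quadratically invariant under $[\,\mathcal P_{12}\ \ \mathcal P_{13}\,]$ if $\mathcal K\mathcal P\mathcal K\in\mathcal S_1\times\mathcal S_2$ for all $\mathcal K\in\mathcal S_1\times\mathcal S_2$. **Saddle points.** $(\bar{\mathcal Q}_1,\bar{\mathcal Q}_2)\in\mathcal S_1\times\mathcal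 S_2$ is a saddle point equilibrium in the disturbance feedforward strategies if, for all $\mathcal Q_1\in\mathcal S_1$, $\mathcal Q_2\in\mathcal S_2$, $$\mathcal J\left(\begin{bmatrix}\bar{\mathcal Q}_1\\ \mathcal Q_2\end{bmatrix}\right)\le\mathcal J\left(\begin{bmatrix}\bar{\mathcal Q}_1\\ \bar{\mathcal Q}_2\end{bmatrix}\right)\le\mathcal J\left(\begin{bmatrix}\mathcal Q_1\\ \bar{\mathcal Q}_2\end{bmatrix}\right).$$ $(\hat{\mathcal K}_1,\hat{\mathcal K}_2)\in\mathcal S_1\times\mathcal S_2$ is a saddle point equilibrium in the state feedback strategies if, for all $\mathcal K_1\in\mathcal S_1$, $\mathcal K_2\in\mathcal S_2$, $$\mathcal J\left(g^{-1}\left(\begin{bmatrix}\hat{\mathcal K}_1\\ \mathcal K_2\end{bmatrix}\right)\right)\le\mathcal J\left(g^{-1}\left(\begin{bmatrix}\hat{\mathcal K}_1\\ \hat{\mathcal K}_2\end{bmatrix}\right)\right)\le\mathcal J\left(g^{-1}\left(\begin{bmatrix}\mathcal K_1\\ \hat{\mathcal K}_2\end{bmatrix}\right)\right).$$ (Under the positive definiteness assumption in the claim, the paper takes it as known that the saddle point equilibrium in disturbance feedforward strategies exists and is unique.) *)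

theory Defs
  imports
    "HOL-Probability.Probability"
    "Jordan_Normal_Form.Gauss_Jordan_Elimination"
begin

unbundle no vec_syntax
no_notation inner (infix "\<bullet>" 70)
hide_type (open) Finite_Cartesian_Product.vec
hide_const (open) Finite_Cartesian_Product.vec Finite_Cartesian_Product.mat

section \<open>Matrices\<close>

text \<open>Meaningful for invertible matrices only; \<open>mat_inverse\<close> returns \<open>None\<close> otherwise.\<close>

definition mat_inv :: "real mat \<Rightarrow> real mat" where
  "mat_inv X = the (mat_inverse X)"

definition sym_mat :: "real mat \<Rightarrow> bool" where
  "sym_mat X \<longleftrightarrow> X\<^sup>T = X"

definition pos_def_mat :: "real mat \<Rightarrow> bool" where
  "pos_def_mat X \<longleftrightarrow> square_mat X \<and> sym_mat X \<and>
     (\<forall>a \<in> carrier_vec (dim_row X). a \<noteq> 0\<^sub>v (dim_row X) \<longrightarrow> a \<bullet> (X *\<^sub>v a) > 0)"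

definition append_cols :: "real mat \<Rightarrow> real mat \<Rightarrow> real mat" (infixr "@\<^sub>c" 65) where
  "X @\<^sub>c Y = four_block_mat X Y (0\<^sub>m 0 (dim_col X)) (0\<^sub>m 0 (dim_col Y))"

definition top_rows :: "nat \<Rightarrow> real mat \<Rightarrow> real mat" where
  "top_rows k X = mat k (dim_col X) (\<lambda>(i, j). X $$ (i, j))"

definition bottom_rows :: "nat \<Rightarrow> real mat \<Rightarrow> real mat" where
  "bottom_rows k X = mat (dim_row X - k) (dim_col X) (\<lambda>(i, j). X $$ (k + i, j))"

lemma top_rows_append_rows:
  assumes "X \<in> carrier_mat k c" and "Y \<in> carrier_mat l c"
  shows "top_rows k (X @\<^sub>r Y) = X"
  using assms by (intro eq_matI) (auto simp: top_rows_def append_rows_def)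

lemma bottom_rows_append_rows:
  assumes "X \<in> carrier_mat k c" and "Y \<in> carrier_mat l c"
  shows "bottom_rows k (X @\<^sub>r Y) = Y"
  using assms by (intro eq_matI) (auto simp: bottom_rows_def append_rows_def)


section \<open>Gaussian random vectors\<close>

text \<open>A random variable is normal if it has a normal density or is almost surely constant
  (variance zero).  A random vector is Gaussian if all its linear functionals are normal.\<close>

definition normal_rv :: "'w measure \<Rightarrow> ('w \<Rightarrow> real) \<Rightarrow> bool" where
  "normal_rv \<Omega> X \<longleftrightarrow>
     (\<exists>\<mu> \<sigma>. 0 < \<sigma> \<and> distributed \<Omega> lborel X (normal_density \<mu> \<sigma>)) \<or>
     (\<exists>\<mu>. X \<in> borel_measurable \<Omega> \<and> (AE \<omega> in \<Omega>. X \<omega> = \<mu>))"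

definition gaussian_vec :: "'w measure \<Rightarrow> nat \<Rightarrow> ('w \<Rightarrow> real vec) \<Rightarrow> bool" where
  "gaussian_vec \<Omega> k W \<longleftrightarrow>
     (\<forall>\<omega> \<in> space \<Omega>. W \<omega> \<in> carrier_vec k) \<and>
     (\<forall>a \<in> carrier_vec k. normal_rv \<Omega> (\<lambda>\<omega>. a \<bullet> W \<omega>))"

definition mean_vec :: "'w measure \<Rightarrow> nat \<Rightarrow> ('w \<Rightarrow> real vec) \<Rightarrow> real vec" where
  "mean_vec \<Omega> k W = vec k (\<lambda>i. \<integral>\<omega>. W \<omega> $ i \<partial>\<Omega>)"

definition cov_mat :: "'w measure \<Rightarrow> nat \<Rightarrow> ('w \<Rightarrow> real vec) \<Rightarrow> real mat" where
  "cov_mat \<Omega> k W = mat k k (\<lambda>(i, j).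
     \<integral>\<omega>. (W \<omega> $ i - mean_vec \<Omega> k W $ i) * (W \<omega> $ j - mean_vec \<Omega> k W $ j) \<partial>\<Omega>)"


section \<open>Dynamics\<close>

definition vec_block :: "nat \<Rightarrow> real vec \<Rightarrow> nat \<Rightarrow> real vec" where
  "vec_block k a t = vec k (\<lambda>i. a $ (t * k + i))"

text \<open>Here \<open>w\<close> stacks the initial state (block \<open>0\<close>) and the disturbances, so the
  disturbance acting at time \<open>t\<close> is block \<open>t + 1\<close>.\<close>

primrec state :: "nat \<Rightarrow> nat \<Rightarrow> nat \<Rightarrow> real mat \<Rightarrow> real mat \<Rightarrow> real mat \<Rightarrow>
    real vec \<Rightarrow> real vec \<Rightarrow> real vec \<Rightarrow> nat \<Rightarrow> real vec" where
  "state n m1 m2 A B1 B2 u v w 0 = vec_block n w 0"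
| "state n m1 m2 A B1 B2 u v w (Suc t) =
     A *\<^sub>v state n m1 m2 A B1 B2 u v w t + B1 *\<^sub>v vec_block m1 u t + B2 *\<^sub>v vec_block m2 v t
       + vec_block n w (Suc t)"

definition trajectory :: "nat \<Rightarrow> nat \<Rightarrow> nat \<Rightarrow> nat \<Rightarrow> real mat \<Rightarrow> real mat \<Rightarrow> real mat \<Rightarrow>
    real vec \<Rightarrow> real vec \<Rightarrow> real vec \<Rightarrow> real vec" where
  "trajectory n m1 m2 N A B1 B2 u v w =
     vec (n * (N + 1)) (\<lambda>i. state n m1 m2 A B1 B2 u v w (i div n) $ (i mod n))"

definition stack_A :: "nat \<Rightarrow> real mat \<Rightarrow> real mat" where
  "stack_A N A = diag_block_mat (replicate (N + 1) A)"

definition stack_B :: "nat \<Rightarrow> nat \<Rightarrow> nat \<Rightarrow> real mat \<Rightarrow> real mat" where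
  "stack_B n m N B = diag_block_mat (replicate N B) @\<^sub>r 0\<^sub>m n (m * N)"

definition block_shift :: "nat \<Rightarrow> nat \<Rightarrow> real mat" where
  "block_shift n N = mat (n * (N + 1)) (n * (N + 1)) (\<lambda>(i, j). if i = j + n then 1 else 0)"

definition P_dist :: "nat \<Rightarrow> nat \<Rightarrow> real mat \<Rightarrow> real mat" where
  "P_dist n N A = mat_inv (1\<^sub>m (n * (N + 1)) - block_shift n N * stack_A N A)"

definition P_input :: "nat \<Rightarrow> nat \<Rightarrow> nat \<Rightarrow> real mat \<Rightarrow> real mat \<Rightarrow> real mat" where
  "P_input n m N A B = P_dist n N A * block_shift n N * stack_B n m N B"

definition P_inputs :: "nat \<Rightarrow> nat \<Rightarrow> nat \<Rightarrow> nat \<Rightarrow> real mat \<Rightarrow> real mat \<Rightarrow> real mat \<Rightarrow> real mat" where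
  "P_inputs n m1 m2 N A B1 B2 = P_input n m1 N A B1 @\<^sub>c P_input n m2 N A B2"


section \<open>Cost\<close>

definition stack_M :: "nat \<Rightarrow> nat \<Rightarrow> (nat \<Rightarrow> real mat) \<Rightarrow> real mat" where
  "stack_M n N M = diag_block_mat (0\<^sub>m n n # map M [1..<N + 1])"

definition stack_input_weight :: "nat \<Rightarrow> (nat \<Rightarrow> real mat) \<Rightarrow> real mat" where
  "stack_input_weight N R = diag_block_mat (map R [0..<N])"

definition game_cost :: "'w measure \<Rightarrow> ('w \<Rightarrow> real vec) \<Rightarrow> nat \<Rightarrow> nat \<Rightarrow> nat \<Rightarrow> nat \<Rightarrow>
    real mat \<Rightarrow> real mat \<Rightarrow> real mat \<Rightarrow>
    (nat \<Rightarrow> real mat) \<Rightarrow> (nat \<Rightarrow> real mat) \<Rightarrow> (nat \<Rightarrow> real mat) \<Rightarrow>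
    ('w \<Rightarrow> real vec) \<Rightarrow> ('w \<Rightarrow> real vec) \<Rightarrow> real" where
  "game_cost \<Omega> W n m1 m2 N A B1 B2 M R V u v =
     (\<integral>\<omega>. (let x = trajectory n m1 m2 N A B1 B2 (u \<omega>) (v \<omega>) (W \<omega>) in
        x \<bullet> (stack_M n N M *\<^sub>v x)
        + u \<omega> \<bullet> (stack_input_weight N R *\<^sub>v u \<omega>)
        + v \<omega> \<bullet> (stack_input_weight N V *\<^sub>v v \<omega>)) \<partial>\<Omega>)"

text \<open>The cost of a pair of disturbance feedforward gains, as a function of the stacked
  gain \<open>Q\<close>, whose first \<open>m1 * N\<close> rows belong to the first team.\<close>

definition feedforward_cost :: "'w measure \<Rightarrow> ('w \<Rightarrow> real vec) \<Rightarrow> nat \<Rightarrow> nat \<Rightarrow> nat \<Rightarrow> nat \<Rightarrow>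
    real mat \<Rightarrow> real mat \<Rightarrow> real mat \<Rightarrow>
    (nat \<Rightarrow> real mat) \<Rightarrow> (nat \<Rightarrow> real mat) \<Rightarrow> (nat \<Rightarrow> real mat) \<Rightarrow> real mat \<Rightarrow> real" where
  "feedforward_cost \<Omega> W n m1 m2 N A B1 B2 M R V Q =
     game_cost \<Omega> W n m1 m2 N A B1 B2 M R V
       (\<lambda>\<omega>. (top_rows (m1 * N) Q * P_dist n N A) *\<^sub>v W \<omega>)
       (\<lambda>\<omega>. (bottom_rows (m1 * N) Q * P_dist n N A) *\<^sub>v W \<omega>)"


section \<open>Information structures and strategies\<close>

definition info_structure :: "nat \<Rightarrow> nat \<Rightarrow> nat \<Rightarrow> nat mat \<Rightarrow> bool" where
  "info_structure n m N S \<longleftrightarrow> S \<in> carrier_mat (m * N) (n * (N + 1)) \<and> elements_mat S \<subseteq> {0, 1}"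

definition gains :: "nat mat \<Rightarrow> real mat set" where
  "gains S = {K \<in> carrier_mat (dim_row S) (dim_col S).
     \<forall>j < dim_row S. \<forall>k < dim_col S. S $$ (j, k) = 0 \<longrightarrow> K $$ (j, k) = 0}"

definition causal :: "nat \<Rightarrow> nat \<Rightarrow> nat \<Rightarrow> nat mat \<Rightarrow> bool" where
  "causal n m N S \<longleftrightarrow>
     (\<forall>K \<in> gains S. \<forall>t < N. \<forall>s \<le> N. s > t \<longrightarrow>
        (\<forall>i < m. \<forall>j < n. K $$ (t * m + i, s * n + j) = 0))"

definition stacked_gains :: "nat mat \<Rightarrow> nat mat \<Rightarrow> real mat set" where
  "stacked_gains S1 S2 = {K1 @\<^sub>r K2 | K1 K2. K1 \<in> gains S1 \<and> K2 \<in> gains S2}"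

definition mutually_quadratically_invariant :: "nat mat \<Rightarrow> nat mat \<Rightarrow> real mat \<Rightarrow> bool" where
  "mutually_quadratically_invariant S1 S2 P \<longleftrightarrow>
     (\<forall>K \<in> stacked_gains S1 S2. K * P * K \<in> stacked_gains S1 S2)"

definition g_map :: "real mat \<Rightarrow> real mat \<Rightarrow> real mat" where
  "g_map P Q = mat_inv (1\<^sub>m (dim_row Q) + Q * P) * Q"

definition g_inv :: "real mat \<Rightarrow> real mat \<Rightarrow> real mat" where
  "g_inv P K = K * mat_inv (1\<^sub>m (dim_row P) - P * K)"

definition feedback_cost :: "'w measure \<Rightarrow> ('w \<Rightarrow> real vec) \<Rightarrow> nat \<Rightarrow> nat \<Rightarrow> nat \<Rightarrow> nat \<Rightarrow>
    real mat \<Rightarrow> real mat \<Rightarrow> real mat \<Rightarrow>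
    (nat \<Rightarrow> real mat) \<Rightarrow> (nat \<Rightarrow> real mat) \<Rightarrow> (nat \<Rightarrow> real mat) \<Rightarrow> real mat \<Rightarrow> real" where
  "feedback_cost \<Omega> W n m1 m2 N A B1 B2 M R V K =
     feedforward_cost \<Omega> W n m1 m2 N A B1 B2 M R V (g_inv (P_inputs n m1 m2 N A B1 B2) K)"

text \<open>The first team minimizes the cost \<open>F\<close> of the stacked gain, the second one maximizes it.\<close>

definition saddle_point :: "nat mat \<Rightarrow> nat mat \<Rightarrow> (real mat \<Rightarrow> real) \<Rightarrow>
    real mat \<Rightarrow> real mat \<Rightarrow> bool" where
  "saddle_point S1 S2 F X1 X2 \<longleftrightarrow> X1 \<in> gains S1 \<and> X2 \<in> gains S2 \<and>
     (\<forall>Y1 \<in> gains S1. \<forall>Y2 \<in> gains S2.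
        F (X1 @\<^sub>r Y2) \<le> F (X1 @\<^sub>r X2) \<and> F (X1 @\<^sub>r X2) \<le> F (Y1 @\<^sub>r X2))"

end

theory Submission
  imports Defs "Jordan_Normal_Form.Determinant"
begin

text \<open>
  At a saddle point in feedback strategies the cost is stationary in every single-entry
  direction \<open>D\<close> allowed by the information structures. By causality \<open>P K\<close> is strictly lower
  triangular, and along such a direction \<open>g_inv P (K + t D)\<close> is exactly affine in \<open>t\<close>, so
  that no analysis is needed: a quadratic polynomial in \<open>t\<close> with an extremum at \<open>0\<close> has no
  linear term. Since stationarity is linear in the direction, the two one-sided conditions
  combine, and mutual quadratic invariance makes the derivative of \<open>g_inv P\<close> a bijection of
  the product of the two structures. Hence \<open>g_inv P K\<close> is a critical point of the quadratic
  feedforward cost, as is the feedforward saddle point. By the definiteness hypothesis the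
  Hessian is nondegenerate, so the two coincide, and \<open>g_map P\<close> inverts \<open>g_inv P\<close>.
\<close>

section \<open>Matrix algebra\<close>

text \<open>The obstacle is that \<open>g_inv P\<close> does not respect the split into teams:
  changing \<open>K2\<close> with \<open>K1\<close> fixed moves both blocks of
  \<open>g_inv P K\<close>, since the first team reacts to the changed state. The saddle
  inequalities therefore cannot be carried over one by one; stationarity can, because it has no
  sign. Single entries serve two purposes: each belongs to one team, and a matrix unit
  \<open>D\<close> has rank one, so \<open>D T P D\<close> with \<open>T = (1 - P K)^(-1)\<close> is
  a multiple of \<open>D\<close>. Solvability for every \<open>t\<close> forces that multiple to
  vanish, which removes all higher powers of \<open>t\<close>. Mutual quadratic invariance speaks
  about the squares \<open>K P K\<close> only, so products of different gains are reached in
  symmetrized form; this is the origin of the factors 1/2. Nondegeneracy is needed on the structured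
  subspace, and an indefinite form may degenerate on a subspace even if it is nondegenerate on the
  whole space. What saves it is that the structure is a product: negating the second team's block
  stays inside, and this turns the indefinite form into a definite one.\<close>

text \<open>Distributivity and associativity with side conditions on dimensions, which the
  simplifier can discharge, instead of carrier sets.\<close>

lemma mult_assoc_dim:
  fixes X Y Z :: "real mat"
  assumes "dim_col X = dim_row Y" and "dim_col Y = dim_row Z"
  shows "X * Y * Z = X * (Y * Z)"
  using assms by (intro assoc_mult_mat) auto

lemma mult_add_dim:
  fixes X Y Z :: "real mat"
  assumes "dim_col X = dim_row Y" and "dim_row Y = dim_row Z" and "dim_col Y = dim_col Z"
  shows "X * (Y + Z) = X * Y + X * Z"
  using assms by (intro mult_add_distrib_mat[of _ "dim_row X" "dim_row Y" _ "dim_col Y"]) auto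

lemma add_mult_dim:
  fixes X Y Z :: "real mat"
  assumes "dim_col Y = dim_row X" and "dim_row Y = dim_row Z" and "dim_col Y = dim_col Z"
  shows "(Y + Z) * X = Y * X + Z * X"
  using assms by (intro add_mult_distrib_mat[of _ "dim_row Y" "dim_row X" _ _ "dim_col X"]) auto

lemma mult_minus_dim:
  fixes X Y Z :: "real mat"
  assumes "dim_col X = dim_row Y" and "dim_row Y = dim_row Z" and "dim_col Y = dim_col Z"
  shows "X * (Y - Z) = X * Y - X * Z"
  using assms by (intro mult_minus_distrib_mat[of _ "dim_row X" "dim_row Y" _ "dim_col Y"]) auto

lemma minus_mult_dim:
  fixes X Y Z :: "real mat"
  assumes "dim_col Y = dim_row X" and "dim_row Y = dim_row Z" and "dim_col Y = dim_col Z"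
  shows "(Y - Z) * X = Y * X - Z * X"
  using assms by (intro minus_mult_distrib_mat[of _ "dim_row Y" "dim_row X" _ _ "dim_col X"]) auto

lemma mult_smult_dim:
  fixes X Y :: "real mat"
  assumes "dim_col X = dim_row Y"
  shows "X * (a \<cdot>\<^sub>m Y) = a \<cdot>\<^sub>m (X * Y)"
  using assms by (intro mult_smult_distrib[of _ "dim_row X" "dim_row Y" _ "dim_col Y"]) auto

lemma smult_mult_dim:
  fixes X Y :: "real mat"
  assumes "dim_col X = dim_row Y"
  shows "(a \<cdot>\<^sub>m X) * Y = a \<cdot>\<^sub>m (X * Y)"
  using assms by (intro mult_smult_assoc_mat[of _ "dim_row X" "dim_row Y" _ "dim_col Y"]) auto

lemma one_mult_dim: "dim_row X = k \<Longrightarrow> 1\<^sub>m k * X = (X :: real mat)"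
  and mult_one_dim: "dim_col X = k \<Longrightarrow> X * 1\<^sub>m k = X"
  by (auto intro: left_mult_one_mat right_mult_one_mat)

lemmas mat_distribs = mult_assoc_dim mult_add_dim add_mult_dim mult_minus_dim minus_mult_dim
  mult_smult_dim smult_mult_dim one_mult_dim mult_one_dim

section \<open>Inverses and the maps between feedback and feedforward gains\<close>

lemma mat_diff_eqD:
  fixes X Y Z :: "real mat"
  assumes "X - Y = Z" and "dim_row X = dim_row Y" and "dim_col X = dim_col Y"
  shows "Y = X - Z"
  using assms(2,3) by (auto simp flip: assms(1))

text \<open>A one-sided inverse of a square matrix is two-sided, so \<open>X\<close> is a unit and
  the \<open>None\<close> branch of \<open>mat_inverse\<close> is excluded; uniqueness of inverses
  does the rest. The inverses in \<open>g_map\<close> and \<open>g_inv\<close> are evaluated this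
  way, by exhibiting a candidate and checking one product.\<close>

lemma mat_inv_eqI:
  assumes "X \<in> carrier_mat k k" and "Y \<in> carrier_mat k k" and "X * Y = 1\<^sub>m k"
  shows "mat_inv X = Y"
proof -
  have YX: "Y * X = 1\<^sub>m k"
    using mat_mult_left_right_inverse[OF assms] .
  have "mat_inverse X \<noteq> None"
    using mat_inverse(1)[OF assms(1), of undefined] assms YX
    by (auto simp: Units_def ring_mat_def)
  then obtain Z where Z: "mat_inverse X = Some Z"
    by auto
  then have "X * Z = 1\<^sub>m k" and car: "Z \<in> carrier_mat k k"
    using mat_inverse(2)[OF assms(1) Z] by auto
  then have "Y * (X * Z) = Y"
    using assms by simp
  moreover have "Y * (X * Z) = Z"
    using YX assms car by (simp add: mat_distribs flip: mult_assoc_dim)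
  ultimately show ?thesis
    using Z by (simp add: mat_inv_def)
qed

lemma invertible_mat_inv:
  assumes X: "X \<in> carrier_mat k k" and "Determinant.det X \<noteq> 0"
  shows "mat_inv X \<in> carrier_mat k k" and "X * mat_inv X = 1\<^sub>m k" and "mat_inv X * X = 1\<^sub>m k"
proof -
  obtain Y where Y: "Y \<in> carrier_mat k k" "X * Y = 1\<^sub>m k" "Y * X = 1\<^sub>m k"
    using det_non_zero_imp_unit[OF assms, of undefined] by (auto simp: Units_def ring_mat_def)
  with mat_inv_eqI[OF X this(1,2)]
  show "mat_inv X \<in> carrier_mat k k" "X * mat_inv X = 1\<^sub>m k" "mat_inv X * X = 1\<^sub>m k"
    by simp_all
qed

text \<open>With \<open>T = (1 - P K)^(-1)\<close> the push-through identity gives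
  \<open>1 + K T P = (1 - K P)^(-1)\<close>, and then \<open>(1 - K P) K = K (1 - P K)\<close>
  cancels \<open>T\<close>.\<close>

lemma g_map_g_inv:
  assumes P: "P \<in> carrier_mat c r" and K: "K \<in> carrier_mat r c" and T: "T \<in> carrier_mat c c"
    and inv: "(1\<^sub>m c - P * K) * T = 1\<^sub>m c"
  shows "g_map P (g_inv P K) = K"
proof -
  note d = carrier_matD[OF P] carrier_matD[OF K] carrier_matD[OF T]
  have car: "1\<^sub>m c - P * K \<in> carrier_mat c c"
    using P K by (intro minus_carrier_mat) auto
  have inv': "T * (1\<^sub>m c - P * K) = 1\<^sub>m c"
    using mat_mult_left_right_inverse[OF car T inv] .
  have g: "g_inv P K = K * T"
    using mat_inv_eqI[OF car T inv] P K d by (simp add: g_inv_def)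
  have TPK: "T * (P * K) = T - 1\<^sub>m c"
  proof -
    have "T * (1\<^sub>m c - P * K) = T - T * (P * K)"
      using d by (simp add: mat_distribs)
    then show ?thesis
      using inv' d by (intro mat_diff_eqD) simp_all
  qed
  \<comment> \<open>The rewriting rules nest products to the right, so \<open>T * (P * K)\<close>
    shows up only in front of a further factor \<open>X\<close>; hence this variant.\<close>
  have TPKX: "T * (P * (K * X)) = T * X - X" if "dim_row X = c" for X
  proof -
    have "T * (P * (K * X)) = (T * (P * K)) * X"
      using d that by (simp add: mat_distribs)
    also have "\<dots> = T * X - X"
      unfolding TPK using d that by (simp add: mat_distribs)
    finally show ?thesis .
  qed
  have "(1\<^sub>m r + K * T * P) * (1\<^sub>m r - K * P) = 1\<^sub>m r"
    using d by (simp add: mat_distribs TPKX)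
      (intro eq_matI, auto simp del: index_mult_mat(1) simp: algebra_simps)
  then have "mat_inv (1\<^sub>m r + K * T * P) = 1\<^sub>m r - K * P"
    using P K T by (intro mat_inv_eqI) auto
  then have "g_map P (K * T) = (1\<^sub>m r - K * P) * (K * T)"
    using d by (simp add: g_map_def)
  also have "\<dots> = K * ((1\<^sub>m c - P * K) * T)"
    using d by (simp add: mat_distribs)
  also have "\<dots> = K"
    unfolding inv using d by (simp add: mat_distribs)
  finally show ?thesis
    by (simp add: g)
qed

text \<open>The resolvent expands as \<open>T + t T P D T + t^2 T P D T P D T + ...\<close>, and
  \<open>D T P D = 0\<close> kills every term beyond first order, here and in the product with
  \<open>K + t D\<close>. The coefficient of \<open>t\<close> is the derivative of
  \<open>g_inv P\<close> at \<open>K\<close> in direction \<open>D\<close>.\<close>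

lemma g_inv_perturb:
  assumes P: "P \<in> carrier_mat c r" and K: "K \<in> carrier_mat r c" and T: "T \<in> carrier_mat c c"
    and D: "D \<in> carrier_mat r c"
    and inv: "(1\<^sub>m c - P * K) * T = 1\<^sub>m c"
    and nil: "D * (T * (P * D)) = 0\<^sub>m r c"
  shows "g_inv P (K + t \<cdot>\<^sub>m D) = g_inv P K + t \<cdot>\<^sub>m ((1\<^sub>m r + K * T * P) * D * T)"
proof -
  note d = carrier_matD[OF P] carrier_matD[OF K] carrier_matD[OF T] carrier_matD[OF D]
  have car: "1\<^sub>m c - P * K \<in> carrier_mat c c"
    using P K by (intro minus_carrier_mat) auto
  have g: "g_inv P K = K * T"
    using mat_inv_eqI[OF car T inv] P K d by (simp add: g_inv_def)
  have PKT1: "P * (K * T) = T - 1\<^sub>m c"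
  proof -
    have "(1\<^sub>m c - P * K) * T = T - P * (K * T)"
      using d by (simp add: mat_distribs)
    then show ?thesis
      using inv d by (intro mat_diff_eqD) simp_all
  qed
  have PKT: "P * (K * (T * X)) = T * X - X" if "dim_row X = c" for X
  proof -
    have "P * (K * (T * X)) = (P * (K * T)) * X"
      using d that by (simp add: mat_distribs)
    also have "\<dots> = T * X - X"
      unfolding PKT1 using d that by (simp add: mat_distribs)
    finally show ?thesis .
  qed
  have nilX: "D * (T * (P * (D * X))) = 0\<^sub>m r (dim_col X)" if "dim_row X = c" for X
  proof -
    have "D * (T * (P * (D * X))) = D * (T * (P * D)) * X"
      using d that by (simp add: mat_distribs)
    then show ?thesis
      using nil that by simp
  qed
  define T2 where "T2 = T + t \<cdot>\<^sub>m (T * (P * (D * T)))"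
  have "(1\<^sub>m c - P * (K + t \<cdot>\<^sub>m D)) * T2 = 1\<^sub>m c"
    unfolding T2_def using d P
    by (simp add: mat_distribs PKT PKT1 nilX)
      (intro eq_matI, auto simp del: index_mult_mat(1) simp: algebra_simps)
  then have "mat_inv (1\<^sub>m c - P * (K + t \<cdot>\<^sub>m D)) = T2"
    using P K T D by (intro mat_inv_eqI) (auto simp: T2_def intro!: minus_carrier_mat)
  then have "g_inv P (K + t \<cdot>\<^sub>m D) = (K + t \<cdot>\<^sub>m D) * T2"
    using d by (simp add: g_inv_def)
  also have "\<dots> = K * T + t \<cdot>\<^sub>m ((1\<^sub>m r + K * T * P) * D * T)"
    unfolding T2_def using d
    by (simp add: mat_distribs nilX)
      (intro eq_matI, auto simp del: index_mult_mat(1) simp: algebra_simps)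
  finally show ?thesis
    by (simp add: g)
qed

section \<open>Information structures and stationarity\<close>

definition unit_mat :: "nat \<Rightarrow> nat \<Rightarrow> nat \<Rightarrow> nat \<Rightarrow> real mat" where
  "unit_mat r c j k = mat r c (\<lambda>(a, b). if a = j \<and> b = k then 1 else 0)"

lemma unit_mat_carrier [simp]: "unit_mat r c j k \<in> carrier_mat r c"
  and unit_mat_dim [simp]: "dim_row (unit_mat r c j k) = r" "dim_col (unit_mat r c j k) = c"
  by (simp_all add: unit_mat_def)

text \<open>A matrix unit has rank one, so only one scalar of \<open>Y\<close> survives between two
  copies. With \<open>Y = T * P\<close> it makes \<open>D T P D\<close> a multiple of
  \<open>D\<close>.\<close>

lemma unit_mat_sandwich:
  assumes Y: "Y \<in> carrier_mat c r" and "j < r" and "k < c"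
  shows "unit_mat r c j k * (Y * unit_mat r c j k) = Y $$ (k, j) \<cdot>\<^sub>m unit_mat r c j k"
proof -
  have "Y * unit_mat r c j k = mat c c (\<lambda>(a, b). if b = k then Y $$ (a, j) else 0)"
    using assms
    by (intro eq_matI) (auto simp: scalar_prod_def unit_mat_def if_distrib[of "\<lambda>z. _ * z"] cong: if_cong)
  then show ?thesis
    using assms
    by (intro eq_matI) (auto simp: scalar_prod_def unit_mat_def if_distrib[of "\<lambda>z. z * _"] cong: if_cong)
qed

lemma gains_carrier: "S \<in> carrier_mat r c \<Longrightarrow> X \<in> gains S \<Longrightarrow> X \<in> carrier_mat r c"
  by (auto simp: gains_def)

lemma gains_add: "X \<in> gains S \<Longrightarrow> Y \<in> gains S \<Longrightarrow> X + Y \<in> gains S"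
  and gains_minus: "X \<in> gains S \<Longrightarrow> Y \<in> gains S \<Longrightarrow> X - Y \<in> gains S"
  and gains_smult: "X \<in> gains S \<Longrightarrow> a \<cdot>\<^sub>m X \<in> gains S"
  by (auto simp: gains_def minus_carrier_mat)

lemma unit_mat_gains:
  "S \<in> carrier_mat r c \<Longrightarrow> S $$ (j, k) \<noteq> 0 \<Longrightarrow> unit_mat r c j k \<in> gains S"
  by (auto simp: gains_def unit_mat_def)

text \<open>\<open>gains S\<close> is spanned by the matrix units on the support of
  \<open>S\<close>. This merges the stationarity conditions of the two teams: conditions entry by
  entry suffice for the whole product structure.\<close>

lemma linear_zero_on_gains:
  fixes f :: "real mat \<Rightarrow> real"
  assumes add: "\<And>X Y. X \<in> carrier_mat r c \<Longrightarrow> Y \<in> carrier_mat r c \<Longrightarrow> f (X + Y) = f X + f Y"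
    and smult: "\<And>a X. X \<in> carrier_mat r c \<Longrightarrow> f (a \<cdot>\<^sub>m X) = a * f X"
    and S: "S \<in> carrier_mat r c"
    and unit: "\<And>j k. j < r \<Longrightarrow> k < c \<Longrightarrow> S $$ (j, k) \<noteq> 0 \<Longrightarrow> f (unit_mat r c j k) = 0"
    and X: "X \<in> gains S"
  shows "f X = 0"
proof -
  define restr where "restr I = mat r c (\<lambda>ij. if ij \<in> I then X $$ ij else 0)" for I
  have restr_car: "restr I \<in> carrier_mat r c" for I
    by (simp add: restr_def)
  have Xc: "X \<in> carrier_mat r c"
    using gains_carrier[OF S X] .
  have "f (restr I) = 0" if "finite I" "I \<subseteq> {..<r} \<times> {..<c}" for I
    using that
  proof (induction I rule: finite_induct)
    case empty
    \<comment> \<open>The empty restriction is the zero matrix, written as a multiple of itself so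
      that homogeneity yields the value zero.\<close>
    have "restr {} = 0 \<cdot>\<^sub>m restr {}"
      by (intro eq_matI) (auto simp: restr_def)
    then have "f (restr {}) = 0 * f (restr {})"
      by (metis smult restr_car)
    then show ?case by simp
  next
    case (insert p I)
    obtain j k where p: "p = (j, k)" "j < r" "k < c"
      using insert.prems by auto
    have "f (X $$ (j, k) \<cdot>\<^sub>m unit_mat r c j k) = X $$ (j, k) * f (unit_mat r c j k)"
      by (simp add: smult)
    also have "\<dots> = 0"
      \<comment> \<open>Off the support the coefficient vanishes; on the support \<open>f\<close>
        vanishes at the matrix unit.\<close>
      using unit[of j k] X S p by (cases "S $$ (j, k) = 0") (auto simp: gains_def)
    finally have "f (X $$ (j, k) \<cdot>\<^sub>m unit_mat r c j k) = 0" .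
    moreover have "restr (insert p I) = restr I + X $$ (j, k) \<cdot>\<^sub>m unit_mat r c j k"
      using p insert.hyps by (intro eq_matI) (auto simp: restr_def unit_mat_def)
    ultimately show ?case
      using insert by (simp add: add restr_car)
  qed
  from this[of "{..<r} \<times> {..<c}"] have "f (restr ({..<r} \<times> {..<c})) = 0"
    by simp
  moreover have "restr ({..<r} \<times> {..<c}) = X"
    using Xc by (intro eq_matI) (auto simp: restr_def)
  ultimately show ?thesis by simp
qed

text \<open>A nonzero \<open>(k, j)\<close> entry \<open>\<alpha>\<close> of \<open>T * P\<close> would make \<open>1 - P * (K + (1 / \<alpha>) D)\<close>
  singular for the matrix unit \<open>D\<close>.\<close>

lemma unit_mat_nilpotent:
  assumes P: "P \<in> carrier_mat c r" and K: "K \<in> carrier_mat r c" and T: "T \<in> carrier_mat c c"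
    and inv: "(1\<^sub>m c - P * K) * T = 1\<^sub>m c" and j: "j < r" and k: "k < c"
    and regular: "\<And>t. \<exists>T' \<in> carrier_mat c c. (1\<^sub>m c - P * (K + t \<cdot>\<^sub>m unit_mat r c j k)) * T' = 1\<^sub>m c"
  shows "unit_mat r c j k * (T * (P * unit_mat r c j k)) = 0\<^sub>m r c"
proof -
  let ?D = "unit_mat r c j k"
  note d = carrier_matD[OF P] carrier_matD[OF K] carrier_matD[OF T]
  define \<alpha> where "\<alpha> = (T * P) $$ (k, j)"
  have sandwich: "?D * (T * (P * ?D)) = \<alpha> \<cdot>\<^sub>m ?D"
    using unit_mat_sandwich[of "T * P" c r j k] P T j k d
    by (simp add: \<alpha>_def mat_distribs del: index_mult_mat(1))
  have "\<alpha> = 0"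
  proof (rule ccontr)
    assume \<alpha>: "\<alpha> \<noteq> 0"
    let ?Y = "1\<^sub>m c - P * (K + (1 / \<alpha>) \<cdot>\<^sub>m ?D)"
    let ?X = "T * (P * ?D)"
    obtain T' where T': "T' \<in> carrier_mat c c" "?Y * T' = 1\<^sub>m c"
      using regular by blast
    have car: "?Y \<in> carrier_mat c c"
      using P K by (intro minus_carrier_mat) auto
    have T'Y: "T' * ?Y = 1\<^sub>m c"
      using mat_mult_left_right_inverse[OF car T'] .
    \<comment> \<open>The columns of \<open>?X\<close> lie in the kernel of \<open>?Y\<close>: the
      first term reduces to \<open>P D\<close>, and the scale \<open>1 / \<alpha>\<close> makes the
      second term equal to it by the sandwich identity.\<close>
    have "?Y * ?X = ((1\<^sub>m c - P * K) * T) * (P * ?D) - (1 / \<alpha>) \<cdot>\<^sub>m (P * (?D * ?X))"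
      using d by (simp add: mat_distribs)
        (intro eq_matI, auto simp del: index_mult_mat(1) simp: algebra_simps)
    also have "\<dots> = 0\<^sub>m c c"
      unfolding inv sandwich using d \<alpha> by (simp add: mat_distribs)
        (intro eq_matI, auto simp del: index_mult_mat(1))
    finally have "T' * (?Y * ?X) = 0\<^sub>m c c"
      using T' by simp
    moreover have "T' * (?Y * ?X) = (T' * ?Y) * ?X"
      using T' car d by (simp add: mult_assoc_dim)
    ultimately have "?X = 0\<^sub>m c c"
      using d by (simp add: T'Y one_mult_dim)
    then have "\<alpha> \<cdot>\<^sub>m ?D = 0\<^sub>m r c"
      using sandwich by (simp add: right_mult_zero_mat[OF unit_mat_carrier])
    then have "(\<alpha> \<cdot>\<^sub>m ?D) $$ (j, k) = 0"
      using j k by simp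
    then show False
      using \<alpha> j k by (simp add: unit_mat_def)
  qed
  then show ?thesis
    using sandwich by (auto intro!: eq_matI)
qed

lemma quadratic_extremum:
  fixes a b :: real
  assumes "(\<forall>t. 0 \<le> t * a + t\<^sup>2 * b) \<or> (\<forall>t. t * a + t\<^sup>2 * b \<le> 0)"
  shows "a = 0"
proof -
  have *: "a = 0" if "\<forall>t. 0 \<le> t * a + t\<^sup>2 * b" for a b :: real
  proof (rule ccontr)
    assume a: "a \<noteq> 0"
    \<comment> \<open>\<open>B\<close> is positive and exceeds \<open>b\<close>, so that the value
      at \<open>t = - a / B\<close> is \<open>(a / B)^2 (b - B)\<close>, which is negative.\<close>
    define B where "B = \<bar>b\<bar> + 1"
    have B: "B > 0" "b - B < 0" by (auto simp: B_def)
    have "(- a / B) * a + (- a / B)\<^sup>2 * b = (a / B)\<^sup>2 * (b - B)"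
      using B by (simp add: field_simps power2_eq_square)
    also have "\<dots> < 0"
      using a B by (simp add: mult_pos_neg)
    finally show False
      using that by (meson not_le)
  qed
  show ?thesis
    using assms
  proof
    assume "\<forall>t. t * a + t\<^sup>2 * b \<le> 0"
    then have "0 \<le> t * (- a) + t\<^sup>2 * (- b)" for t
      by (drule_tac spec[of _ t]) simp
    then have "\<forall>t. 0 \<le> t * (- a) + t\<^sup>2 * (- b)" ..
    from *[OF this] show ?thesis by simp
  qed (rule *)
qed

text \<open>Polarising \<open>K P K\<close> twice shows that the subspace is closed under the Jordan triple
  product \<open>(K, E) \<mapsto> K P E P K\<close>, hence under the inverse derivative of \<open>g_inv P\<close> at \<open>K\<close>.\<close>

lemma quadratically_invariant_sandwich:
  assumes S: "S \<in> carrier_mat r c" and P: "P \<in> carrier_mat c r"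
    and qi: "\<And>K. K \<in> gains S \<Longrightarrow> K * P * K \<in> gains S"
    and K: "K \<in> gains S" and E: "E \<in> gains S"
  shows "(1\<^sub>m r - K * P) * E * (1\<^sub>m c - P * K) \<in> gains S"
proof -
  note d = carrier_matD[OF P]
  have jordan: "X * P * Y + Y * P * X \<in> gains S" if X: "X \<in> gains S" and Y: "Y \<in> gains S" for X Y
  proof -
    note e = carrier_matD[OF gains_carrier[OF S X]] carrier_matD[OF gains_carrier[OF S Y]]
    have "(X + Y) * P * (X + Y) - X * P * X - Y * P * Y \<in> gains S"
      using X Y by (intro gains_minus qi gains_add)
    also have "(X + Y) * P * (X + Y) - X * P * X - Y * P * Y = X * P * Y + Y * P * X"
      using d e by (simp add: mat_distribs)
        (intro eq_matI, auto simp del: index_mult_mat(1) simp: algebra_simps)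
    finally show ?thesis .
  qed
  note e = carrier_matD[OF gains_carrier[OF S K]] carrier_matD[OF gains_carrier[OF S E]]
  define KE where "KE = K * P * E + E * P * K"
  define KK where "KK = K * P * K"
  have KE: "KE \<in> gains S" and KK: "KK \<in> gains S"
    unfolding KE_def KK_def using jordan qi K E by auto
  \<comment> \<open>Expanding cancels the terms with both factors \<open>K\<close> on the same side
    of \<open>E\<close> and leaves \<open>2 K P E P K\<close>, hence the factor 1/2.\<close>
  have "(1/2) \<cdot>\<^sub>m ((K * P * KE + KE * P * K) - (KK * P * E + E * P * KK)) \<in> gains S"
    using K E KE KK by (intro gains_smult gains_minus jordan)
  then have "E - KE + (1/2) \<cdot>\<^sub>m ((K * P * KE + KE * P * K) - (KK * P * E + E * P * KK)) \<in> gains S"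
    using E KE by (intro gains_add gains_minus)
  also have "E - KE + (1/2) \<cdot>\<^sub>m ((K * P * KE + KE * P * K) - (KK * P * E + E * P * KK))
      = (1\<^sub>m r - K * P) * E * (1\<^sub>m c - P * K)"
    unfolding KE_def KK_def using d e
    by (simp add: mat_distribs)
      (intro eq_matI, auto simp del: index_mult_mat(1) simp: algebra_simps)
  finally show ?thesis .
qed

text \<open>\<open>F\<close> stands for any functional that is exactly quadratic along lines, with
  first-order part \<open>L\<close> and second-order part \<open>G\<close>, so no probability
  enters. The kind of extremum may vary from entry to entry. All \<open>E\<close> in the structure
  are reached because each is the image of an admissible direction under the derivative of
  \<open>g_inv P\<close> at \<open>K\<close>.\<close>

lemma feedback_extremum_critical:
  fixes F :: "real mat \<Rightarrow> real"
  assumes S: "S \<in> carrier_mat r c" and P: "P \<in> carrier_mat c r"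
    and qi: "\<And>K. K \<in> gains S \<Longrightarrow> K * P * K \<in> gains S"
    and regular: "\<And>K. K \<in> gains S \<Longrightarrow> \<exists>T \<in> carrier_mat c c. (1\<^sub>m c - P * K) * T = 1\<^sub>m c"
    and quadratic: "\<And>Q D t. Q \<in> carrier_mat r c \<Longrightarrow> D \<in> carrier_mat r c \<Longrightarrow>
      F (Q + t \<cdot>\<^sub>m D) = F Q + t * L Q D + t\<^sup>2 * G D"
    and L_add: "\<And>Q D E. Q \<in> carrier_mat r c \<Longrightarrow> D \<in> carrier_mat r c \<Longrightarrow> E \<in> carrier_mat r c \<Longrightarrow>
      L Q (D + E) = L Q D + L Q E"
    and L_smult: "\<And>Q D a. Q \<in> carrier_mat r c \<Longrightarrow> D \<in> carrier_mat r c \<Longrightarrow>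
      L Q (a \<cdot>\<^sub>m D) = a * L Q D"
    and K: "K \<in> gains S"
    and extremum: "\<And>j k. j < r \<Longrightarrow> k < c \<Longrightarrow> S $$ (j, k) \<noteq> 0 \<Longrightarrow>
      (\<forall>t. F (g_inv P K) \<le> F (g_inv P (K + t \<cdot>\<^sub>m unit_mat r c j k))) \<or>
      (\<forall>t. F (g_inv P (K + t \<cdot>\<^sub>m unit_mat r c j k)) \<le> F (g_inv P K))"
    and E: "E \<in> gains S"
  shows "L (g_inv P K) E = 0"
proof -
  have Kc: "K \<in> carrier_mat r c" and Ec: "E \<in> carrier_mat r c"
    using gains_carrier[OF S] K E by auto
  obtain T where T: "T \<in> carrier_mat c c" and inv: "(1\<^sub>m c - P * K) * T = 1\<^sub>m c"
    using regular[OF K] by blast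
  note d = carrier_matD[OF P] carrier_matD[OF Kc] carrier_matD[OF T] carrier_matD[OF Ec]
  have car: "1\<^sub>m c - P * K \<in> carrier_mat c c"
    using P Kc by (intro minus_carrier_mat) auto
  have inv': "T * (1\<^sub>m c - P * K) = 1\<^sub>m c"
    using mat_mult_left_right_inverse[OF car T inv] .
  define Q where "Q = K * T"
  have g: "g_inv P K = Q"
    using mat_inv_eqI[OF car T inv] P Kc d by (simp add: g_inv_def Q_def)
  have Qc: "Q \<in> carrier_mat r c"
    using Kc T by (simp add: Q_def)
  \<comment> \<open>The derivative of \<open>g_inv P\<close> at \<open>K\<close>; by push-through
    its left factor is the inverse of \<open>1 - K P\<close>.\<close>
  define pull where "pull D = (1\<^sub>m r + Q * P) * D * T" for D
  have pull_car: "pull D \<in> carrier_mat r c" if "D \<in> carrier_mat r c" for D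
    unfolding pull_def using that Qc P T by (intro mult_carrier_mat add_carrier_mat) auto
  have crit: "L Q (pull D) = 0" if D: "D \<in> gains S" for D
  proof (rule linear_zero_on_gains[where f = "\<lambda>D. L Q (pull D)", OF _ _ S _ D])
    fix X Y :: "real mat" assume X: "X \<in> carrier_mat r c" and Y: "Y \<in> carrier_mat r c"
    have "pull (X + Y) = pull X + pull Y"
      unfolding pull_def using X Y Qc P T
      by (simp add: mat_distribs)
        (intro eq_matI, auto simp del: index_mult_mat(1) simp: algebra_simps)
    then show "L Q (pull (X + Y)) = L Q (pull X) + L Q (pull Y)"
      by (simp add: L_add Qc pull_car X Y)
  next
    fix a and X :: "real mat" assume X: "X \<in> carrier_mat r c"
    have "pull (a \<cdot>\<^sub>m X) = a \<cdot>\<^sub>m pull X"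
      unfolding pull_def using X Qc P T
      by (simp add: mat_distribs)
    then show "L Q (pull (a \<cdot>\<^sub>m X)) = a * L Q (pull X)"
      by (simp add: L_smult Qc pull_car X)
  next
    fix j k assume jk: "j < r" "k < c" "S $$ (j, k) \<noteq> 0"
    let ?D = "unit_mat r c j k"
    \<comment> \<open>The whole line stays in the structure, so \<open>1 - P (K + t D)\<close> is
      invertible for every \<open>t\<close>, as the nilpotency argument requires.\<close>
    have "K + t \<cdot>\<^sub>m ?D \<in> gains S" for t
      using K jk S by (intro gains_add gains_smult unit_mat_gains)
    then have nil: "?D * (T * (P * ?D)) = 0\<^sub>m r c"
      using jk by (intro unit_mat_nilpotent[OF P Kc T inv] regular)
    have "g_inv P (K + t \<cdot>\<^sub>m ?D) = Q + t \<cdot>\<^sub>m pull ?D" for t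
      using g_inv_perturb[OF P Kc T unit_mat_carrier inv nil] unfolding g pull_def Q_def .
    then have "F (g_inv P (K + t \<cdot>\<^sub>m ?D)) = F Q + t * L Q (pull ?D) + t\<^sup>2 * G (pull ?D)" for t
      by (simp add: quadratic[OF Qc pull_car])
    then show "L Q (pull ?D) = 0"
      using extremum[OF jk] unfolding g
      by (intro quadratic_extremum[where b = "G (pull ?D)"]) (auto simp: algebra_simps)
  qed
  \<comment> \<open>The solution of \<open>pull D = E\<close>: the outer factors of
    \<open>pull\<close> are the inverses of \<open>1 - K P\<close> and
    \<open>1 - P K\<close>.\<close>
  define D where "D = (1\<^sub>m r - K * P) * E * (1\<^sub>m c - P * K)"
  have "D \<in> gains S"
    unfolding D_def by (rule quadratically_invariant_sandwich[OF S P qi K E])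
  have "pull D = (1\<^sub>m r + Q * P) * (1\<^sub>m r - K * P) * E * ((1\<^sub>m c - P * K) * T)"
    unfolding pull_def D_def Q_def using d by (simp add: mult_assoc_dim)
  also have "\<dots> = (1\<^sub>m r + Q * P) * (1\<^sub>m r - K * P) * E"
    unfolding inv using d by (simp add: mult_one_dim)
  also have "(1\<^sub>m r + Q * P) * (1\<^sub>m r - K * P) = 1\<^sub>m r - K * P + K * (T * (1\<^sub>m c - P * K)) * P"
    unfolding Q_def using d by (simp add: mat_distribs)
      (intro eq_matI, auto simp del: index_mult_mat(1) simp: algebra_simps)
  also have "\<dots> = 1\<^sub>m r"
    unfolding inv' using d by (simp add: mult_one_dim)
      (intro eq_matI, auto simp del: index_mult_mat(1))
  finally have "pull D = E"
    using d by (simp add: one_mult_dim)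
  with crit[OF \<open>D \<in> gains S\<close>] show ?thesis
    by (simp add: g)
qed

section \<open>Second moments of Gaussian vectors\<close>

lemma normal_rv_measurable: "normal_rv \<Omega> X \<Longrightarrow> X \<in> borel_measurable \<Omega>"
  by (auto simp: normal_rv_def distributed_def)

lemma normal_rv_integrable_square:
  assumes "prob_space \<Omega>" and X: "normal_rv \<Omega> X"
  shows "integrable \<Omega> (\<lambda>\<omega>. (X \<omega>)\<^sup>2)"
proof -
  interpret prob_space \<Omega> by fact
  have meas: "X \<in> borel_measurable \<Omega>"
    by (rule normal_rv_measurable[OF X])
  consider (density) \<mu> \<sigma> where "0 < \<sigma>" "distributed \<Omega> lborel X (normal_density \<mu> \<sigma>)"
    | (const) \<mu> where "AE \<omega> in \<Omega>. X \<omega> = \<mu>"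
    using X by (auto simp: normal_rv_def)
  then show ?thesis
  proof cases
    case density
    \<comment> \<open>The expansion of \<open>x^2\<close> about the mean reduces the claim to
      central moments.\<close>
    have "integrable lborel (\<lambda>x. normal_density \<mu> \<sigma> x * (x - \<mu>)^2
        + (2 * \<mu>) * (normal_density \<mu> \<sigma> x * (x - \<mu>)^1) + \<mu>\<^sup>2 * (normal_density \<mu> \<sigma> x * (x - \<mu>)^0))"
      using density(1)
      by (intro Bochner_Integration.integrable_add integrable_mult_right integrable_normal_moment)
    also have "(\<lambda>x. normal_density \<mu> \<sigma> x * (x - \<mu>)^2
        + (2 * \<mu>) * (normal_density \<mu> \<sigma> x * (x - \<mu>)^1) + \<mu>\<^sup>2 * (normal_density \<mu> \<sigma> x * (x - \<mu>)^0))
      = (\<lambda>x. normal_density \<mu> \<sigma> x * x\<^sup>2)"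
      by (auto simp: power2_eq_square algebra_simps)
    finally show ?thesis
      using distributed_integrable[OF density(2), of "\<lambda>x. x\<^sup>2"] by simp
  next
    case const
    have "integrable \<Omega> (\<lambda>\<omega>. (X \<omega>)\<^sup>2) \<longleftrightarrow> integrable \<Omega> (\<lambda>\<omega>. \<mu>\<^sup>2)"
      using const meas by (intro integrable_cong_AE) auto
    then show ?thesis by simp
  qed
qed

text \<open>Normality gives measurable, square integrable components and hence finite expected
  quadratic forms; the zero mean turns \<open>\<Sigma>\<close> into the matrix of second moments;
  definiteness forces a gain to vanish once its product with the noise vanishes almost
  surely.\<close>

locale gaussian_noise = prob_space \<Omega> for \<Omega> :: "'w measure" +
  fixes k :: nat and W :: "'w \<Rightarrow> real Matrix.vec" and \<Sigma> :: "real mat"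
  assumes gaussian: "gaussian_vec \<Omega> k W"
    and mean_zero: "mean_vec \<Omega> k W = 0\<^sub>v k"
    and covariance: "cov_mat \<Omega> k W = \<Sigma>"
    and pos_def: "pos_def_mat \<Sigma>"
begin

lemma W_carrier: "\<omega> \<in> space \<Omega> \<Longrightarrow> W \<omega> \<in> carrier_vec k"
  using gaussian by (auto simp: gaussian_vec_def)

lemma normal_component:
  assumes "i < k"
  shows "normal_rv \<Omega> (\<lambda>\<omega>. unit_vec k i \<bullet> W \<omega>)"
  using gaussian assms by (auto simp: gaussian_vec_def)

lemma component_eq: "i < k \<Longrightarrow> \<omega> \<in> space \<Omega> \<Longrightarrow> unit_vec k i \<bullet> W \<omega> = W \<omega> $ i"
  using W_carrier[of \<omega>] by (simp add: scalar_prod_left_unit)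

lemma measurable_component: "i < k \<Longrightarrow> (\<lambda>\<omega>. W \<omega> $ i) \<in> borel_measurable \<Omega>"
  using normal_rv_measurable[OF normal_component]
  by (subst measurable_cong[where g = "\<lambda>\<omega>. unit_vec k i \<bullet> W \<omega>"]) (auto simp: component_eq)

lemma integrable_component_square: "i < k \<Longrightarrow> integrable \<Omega> (\<lambda>\<omega>. (W \<omega> $ i)\<^sup>2)"
  using normal_rv_integrable_square[OF prob_space_axioms normal_component]
  by (subst Bochner_Integration.integrable_cong[where g = "\<lambda>\<omega>. (unit_vec k i \<bullet> W \<omega>)\<^sup>2"])
    (auto simp: component_eq)

lemma integrable_components:
  assumes "i < k" and "j < k"
  shows "integrable \<Omega> (\<lambda>\<omega>. W \<omega> $ i * W \<omega> $ j)"
proof (rule Bochner_Integration.integrable_bound)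
  show "integrable \<Omega> (\<lambda>\<omega>. (W \<omega> $ i)\<^sup>2 + (W \<omega> $ j)\<^sup>2)"
    using assms by (intro Bochner_Integration.integrable_add integrable_component_square)
  show "(\<lambda>\<omega>. W \<omega> $ i * W \<omega> $ j) \<in> borel_measurable \<Omega>"
    using assms by (intro borel_measurable_times measurable_component)
  have "\<bar>a * b\<bar> \<le> a\<^sup>2 + b\<^sup>2" for a b :: real
  proof -
    have "2 * \<bar>a * b\<bar> \<le> a\<^sup>2 + b\<^sup>2"
      using sum_squares_bound[of "\<bar>a\<bar>" "\<bar>b\<bar>"] by (simp add: abs_mult mult.assoc)
    then show ?thesis
      by linarith
  qed
  then show "AE \<omega> in \<Omega>. norm (W \<omega> $ i * W \<omega> $ j) \<le> norm ((W \<omega> $ i)\<^sup>2 + (W \<omega> $ j)\<^sup>2)"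
    by auto
qed

section \<open>Expected quadratic forms in the noise\<close>

lemma integrable_scalar_prod:
  assumes X: "X \<in> carrier_mat m k" and Y: "Y \<in> carrier_mat m k"
  shows "integrable \<Omega> (\<lambda>\<omega>. (X *\<^sub>v W \<omega>) \<bullet> (Y *\<^sub>v W \<omega>))"
proof -
  have "integrable \<Omega> (\<lambda>\<omega>. \<Sum>i<m. \<Sum>a<k. \<Sum>b<k. (X $$ (i, a) * Y $$ (i, b)) * (W \<omega> $ a * W \<omega> $ b))"
    by (intro Bochner_Integration.integrable_sum integrable_mult_right integrable_components) auto
  moreover have "(X *\<^sub>v W \<omega>) \<bullet> (Y *\<^sub>v W \<omega>)
      = (\<Sum>i<m. \<Sum>a<k. \<Sum>b<k. (X $$ (i, a) * Y $$ (i, b)) * (W \<omega> $ a * W \<omega> $ b))"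
    if "\<omega> \<in> space \<Omega>" for \<omega>
    using W_carrier[OF that] X Y
    by (auto simp: scalar_prod_def sum_product lessThan_atLeast0 intro!: sum.cong)
  ultimately show ?thesis
    by (subst Bochner_Integration.integrable_cong) auto
qed

text \<open>The trace of \<open>X^T H Y \<Sigma>\<close>, a bilinear form on gains. Through it the
  expected cost becomes a quadratic polynomial in the gain.\<close>

definition expected_form :: "real mat \<Rightarrow> real mat \<Rightarrow> real mat \<Rightarrow> real" where
  "expected_form H X Y = (\<integral>\<omega>. (X *\<^sub>v W \<omega>) \<bullet> (H *\<^sub>v (Y *\<^sub>v W \<omega>)) \<partial>\<Omega>)"

lemma integrable_form:
  assumes H: "H \<in> carrier_mat m m" and X: "X \<in> carrier_mat m k" and Y: "Y \<in> carrier_mat m k"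
  shows "integrable \<Omega> (\<lambda>\<omega>. (X *\<^sub>v W \<omega>) \<bullet> (H *\<^sub>v (Y *\<^sub>v W \<omega>)))"
proof -
  have "integrable \<Omega> (\<lambda>\<omega>. (X *\<^sub>v W \<omega>) \<bullet> ((H * Y) *\<^sub>v W \<omega>))"
    using assms by (intro integrable_scalar_prod) auto
  then show ?thesis
    by (subst Bochner_Integration.integrable_cong[where g = "\<lambda>\<omega>. (X *\<^sub>v W \<omega>) \<bullet> ((H * Y) *\<^sub>v W \<omega>)"])
      (auto simp: assoc_mult_mat_vec[OF H Y W_carrier])
qed

lemma expected_form_add_left:
  assumes H: "H \<in> carrier_mat m m" and X: "X \<in> carrier_mat m k" and Y: "Y \<in> carrier_mat m k"
    and Z: "Z \<in> carrier_mat m k"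
  shows "expected_form H (X + Y) Z = expected_form H X Z + expected_form H Y Z"
proof -
  have "((X + Y) *\<^sub>v W \<omega>) \<bullet> (H *\<^sub>v (Z *\<^sub>v W \<omega>))
      = (X *\<^sub>v W \<omega>) \<bullet> (H *\<^sub>v (Z *\<^sub>v W \<omega>)) + (Y *\<^sub>v W \<omega>) \<bullet> (H *\<^sub>v (Z *\<^sub>v W \<omega>))"
    if "\<omega> \<in> space \<Omega>" for \<omega>
    using assms W_carrier[OF that]
    by (subst add_mult_distrib_mat_vec[OF X Y]) (auto intro!: add_scalar_prod_distrib[of _ m])
  then have "expected_form H (X + Y) Z = (\<integral>\<omega>. (X *\<^sub>v W \<omega>) \<bullet> (H *\<^sub>v (Z *\<^sub>v W \<omega>))
      + (Y *\<^sub>v W \<omega>) \<bullet> (H *\<^sub>v (Z *\<^sub>v W \<omega>)) \<partial>\<Omega>)"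
    unfolding expected_form_def by (intro Bochner_Integration.integral_cong) auto
  then show ?thesis
    unfolding expected_form_def
    using integrable_form[OF H X Z] integrable_form[OF H Y Z] by simp
qed

lemma expected_form_smult_left:
  assumes H: "H \<in> carrier_mat m m" and X: "X \<in> carrier_mat m k" and Z: "Z \<in> carrier_mat m k"
  shows "expected_form H (a \<cdot>\<^sub>m X) Z = a * expected_form H X Z"
proof -
  have "((a \<cdot>\<^sub>m X) *\<^sub>v W \<omega>) \<bullet> (H *\<^sub>v (Z *\<^sub>v W \<omega>)) = a * ((X *\<^sub>v W \<omega>) \<bullet> (H *\<^sub>v (Z *\<^sub>v W \<omega>)))"
    if "\<omega> \<in> space \<Omega>" for \<omega>
    using assms W_carrier[OF that]
    by (auto simp: scalar_prod_def sum_distrib_left algebra_simps intro!: sum.cong)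
  then have "expected_form H (a \<cdot>\<^sub>m X) Z = (\<integral>\<omega>. a * ((X *\<^sub>v W \<omega>) \<bullet> (H *\<^sub>v (Z *\<^sub>v W \<omega>))) \<partial>\<Omega>)"
    unfolding expected_form_def by (intro Bochner_Integration.integral_cong) auto
  then show ?thesis
    unfolding expected_form_def by simp
qed

lemma expected_form_commute:
  assumes H: "H \<in> carrier_mat m m" "sym_mat H" and X: "X \<in> carrier_mat m k"
    and Y: "Y \<in> carrier_mat m k"
  shows "expected_form H X Y = expected_form H Y X"
  unfolding expected_form_def
proof (intro Bochner_Integration.integral_cong refl)
  fix \<omega> assume "\<omega> \<in> space \<Omega>"
  then have car: "X *\<^sub>v W \<omega> \<in> carrier_vec m" "Y *\<^sub>v W \<omega> \<in> carrier_vec m"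
    using X Y W_carrier by auto
  have "(X *\<^sub>v W \<omega>) \<bullet> (H *\<^sub>v (Y *\<^sub>v W \<omega>)) = (H\<^sup>T *\<^sub>v (X *\<^sub>v W \<omega>)) \<bullet> (Y *\<^sub>v W \<omega>)"
    using transpose_vec_mult_scalar[OF H(1) car(2,1)] by (rule sym)
  also have "\<dots> = (Y *\<^sub>v W \<omega>) \<bullet> (H *\<^sub>v (X *\<^sub>v W \<omega>))"
    using H car by (simp add: sym_mat_def comm_scalar_prod[of _ m])
  finally show "(X *\<^sub>v W \<omega>) \<bullet> (H *\<^sub>v (Y *\<^sub>v W \<omega>)) = (Y *\<^sub>v W \<omega>) \<bullet> (H *\<^sub>v (X *\<^sub>v W \<omega>))" .
qed

text \<open>Transfers a weight on states to a weight on inputs: with \<open>P\<close> mapping inputs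
  to states it produces the blocks \<open>P^T M P\<close> of the definiteness hypothesis.\<close>

lemma expected_form_pullback:
  assumes H: "H \<in> carrier_mat m m" and P: "P \<in> carrier_mat m l" and X: "X \<in> carrier_mat l k"
    and Y: "Y \<in> carrier_mat l k"
  shows "expected_form H (P * X) (P * Y) = expected_form (P\<^sup>T * H * P) X Y"
  unfolding expected_form_def
proof (intro Bochner_Integration.integral_cong refl)
  fix \<omega> assume "\<omega> \<in> space \<Omega>"
  then have W: "W \<omega> \<in> carrier_vec k"
    by (rule W_carrier)
  then have car: "X *\<^sub>v W \<omega> \<in> carrier_vec l" "Y *\<^sub>v W \<omega> \<in> carrier_vec l"
    using X Y by auto
  have "(P * X *\<^sub>v W \<omega>) \<bullet> (H *\<^sub>v (P * Y *\<^sub>v W \<omega>))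
      = (H *\<^sub>v (P *\<^sub>v (Y *\<^sub>v W \<omega>))) \<bullet> (P *\<^sub>v (X *\<^sub>v W \<omega>))"
    using H P X Y W car
    by (simp add: assoc_mult_mat_vec[OF P X W] assoc_mult_mat_vec[OF P Y W] comm_scalar_prod[of _ m])
  also have "\<dots> = (P\<^sup>T *\<^sub>v (H *\<^sub>v (P *\<^sub>v (Y *\<^sub>v W \<omega>)))) \<bullet> (X *\<^sub>v W \<omega>)"
    using transpose_vec_mult_scalar[OF P car(1), of "H *\<^sub>v (P *\<^sub>v (Y *\<^sub>v W \<omega>))"] H P car by simp
  also have "P\<^sup>T *\<^sub>v (H *\<^sub>v (P *\<^sub>v (Y *\<^sub>v W \<omega>))) = (P\<^sup>T * H * P) *\<^sub>v (Y *\<^sub>v W \<omega>)"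
    using H P car(2)
    by (simp add: assoc_mult_mat_vec[of "P\<^sup>T" l m "H * P" l] assoc_mult_mat_vec[of H m m P l])
  also have "\<dots> \<bullet> (X *\<^sub>v W \<omega>) = (X *\<^sub>v W \<omega>) \<bullet> ((P\<^sup>T * H * P) *\<^sub>v (Y *\<^sub>v W \<omega>))"
    using mult_mat_vec_carrier[OF mult_carrier_mat[OF mult_carrier_mat[OF transpose_carrier_mat[THEN iffD2, OF P] H] P] car(2)]
      car(1) by (rule comm_scalar_prod)
  finally show "(P * X *\<^sub>v W \<omega>) \<bullet> (H *\<^sub>v (P * Y *\<^sub>v W \<omega>))
      = (X *\<^sub>v W \<omega>) \<bullet> ((P\<^sup>T * H * P) *\<^sub>v (Y *\<^sub>v W \<omega>))" .
qed

lemma expected_form_add_weight: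
  assumes H: "H \<in> carrier_mat m m" and H': "H' \<in> carrier_mat m m"
    and X: "X \<in> carrier_mat m k" and Y: "Y \<in> carrier_mat m k"
  shows "expected_form (H + H') X Y = expected_form H X Y + expected_form H' X Y"
proof -
  have "(X *\<^sub>v W \<omega>) \<bullet> ((H + H') *\<^sub>v (Y *\<^sub>v W \<omega>))
      = (X *\<^sub>v W \<omega>) \<bullet> (H *\<^sub>v (Y *\<^sub>v W \<omega>)) + (X *\<^sub>v W \<omega>) \<bullet> (H' *\<^sub>v (Y *\<^sub>v W \<omega>))"
    if "\<omega> \<in> space \<Omega>" for \<omega>
    using assms W_carrier[OF that]
    by (subst add_mult_distrib_mat_vec[OF H H']) (auto intro!: scalar_prod_add_distrib[of _ m])
  then have "expected_form (H + H') X Y = (\<integral>\<omega>. (X *\<^sub>v W \<omega>) \<bullet> (H *\<^sub>v (Y *\<^sub>v W \<omega>))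
      + (X *\<^sub>v W \<omega>) \<bullet> (H' *\<^sub>v (Y *\<^sub>v W \<omega>)) \<partial>\<Omega>)"
    unfolding expected_form_def by (intro Bochner_Integration.integral_cong) auto
  then show ?thesis
    unfolding expected_form_def
    using integrable_form[OF H X Y] integrable_form[OF H' X Y] by simp
qed

lemma expected_form_uminus_weight:
  assumes H: "H \<in> carrier_mat m m" and X: "X \<in> carrier_mat m k" and Y: "Y \<in> carrier_mat m k"
  shows "expected_form (- H) X Y = - expected_form H X Y"
proof -
  have "(X *\<^sub>v W \<omega>) \<bullet> (- H *\<^sub>v (Y *\<^sub>v W \<omega>)) = - ((X *\<^sub>v W \<omega>) \<bullet> (H *\<^sub>v (Y *\<^sub>v W \<omega>)))"
    if "\<omega> \<in> space \<Omega>" for \<omega>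
    using assms W_carrier[OF that] by (subst uminus_mult_mat_vec) auto
  then have "expected_form (- H) X Y = (\<integral>\<omega>. - ((X *\<^sub>v W \<omega>) \<bullet> (H *\<^sub>v (Y *\<^sub>v W \<omega>))) \<partial>\<Omega>)"
    unfolding expected_form_def by (intro Bochner_Integration.integral_cong) auto
  then show ?thesis
    unfolding expected_form_def by simp
qed

lemma expected_square:
  assumes a: "a \<in> carrier_vec k"
  shows "(\<integral>\<omega>. (a \<bullet> W \<omega>)\<^sup>2 \<partial>\<Omega>) = a \<bullet> (\<Sigma> *\<^sub>v a)"
proof -
  have \<Sigma>: "\<Sigma> $$ (i, j) = (\<integral>\<omega>. W \<omega> $ i * W \<omega> $ j \<partial>\<Omega>)" if "i < k" "j < k" for i j
    using that unfolding covariance[symmetric] cov_mat_def mean_zero by simp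
  have "\<Sigma> \<in> carrier_mat k k"
    unfolding covariance[symmetric] cov_mat_def by simp
  then have "a \<bullet> (\<Sigma> *\<^sub>v a) = (\<Sum>i<k. \<Sum>j<k. (a $ i * a $ j) * \<Sigma> $$ (i, j))"
    using a by (auto simp: scalar_prod_def sum_distrib_left lessThan_atLeast0 intro!: sum.cong)
  also have "\<dots> = (\<Sum>i<k. \<Sum>j<k. (a $ i * a $ j) * (\<integral>\<omega>. W \<omega> $ i * W \<omega> $ j \<partial>\<Omega>))"
    by (simp add: \<Sigma>)
  also have "\<dots> = (\<Sum>i<k. \<integral>\<omega>. (\<Sum>j<k. (a $ i * a $ j) * (W \<omega> $ i * W \<omega> $ j)) \<partial>\<Omega>)"
    by (intro sum.cong refl, subst Bochner_Integration.integral_sum)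
      (auto intro!: integrable_mult_right integrable_components)
  also have "\<dots> = (\<integral>\<omega>. (\<Sum>i<k. \<Sum>j<k. (a $ i * a $ j) * (W \<omega> $ i * W \<omega> $ j)) \<partial>\<Omega>)"
    by (subst Bochner_Integration.integral_sum)
      (auto intro!: Bochner_Integration.integrable_sum integrable_mult_right integrable_components)
  also have "\<dots> = (\<integral>\<omega>. (a \<bullet> W \<omega>)\<^sup>2 \<partial>\<Omega>)"
  proof (intro Bochner_Integration.integral_cong refl)
    fix \<omega> assume "\<omega> \<in> space \<Omega>"
    then have "a \<bullet> W \<omega> = (\<Sum>i<k. a $ i * W \<omega> $ i)"
      using W_carrier[of \<omega>] by (simp add: scalar_prod_def lessThan_atLeast0)
    then show "(\<Sum>i<k. \<Sum>j<k. (a $ i * a $ j) * (W \<omega> $ i * W \<omega> $ j)) = (a \<bullet> W \<omega>)\<^sup>2"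
      by (simp add: power2_eq_square sum_product mult.assoc mult.left_commute)
  qed
  finally show ?thesis ..
qed

text \<open>A row \<open>a\<close> of \<open>X\<close> has \<open>a \<bullet> W = 0\<close> almost
  surely, so its second moment \<open>a \<bullet> \<Sigma> a\<close> is zero and definiteness of
  \<open>\<Sigma>\<close> gives \<open>a = 0\<close>.\<close>

lemma zero_image_imp_zero:
  assumes X: "X \<in> carrier_mat m k" and ae: "AE \<omega> in \<Omega>. X *\<^sub>v W \<omega> = 0\<^sub>v m"
  shows "X = 0\<^sub>m m k"
proof -
  have "row X i = 0\<^sub>v k" if i: "i < m" for i
  proof (rule ccontr)
    assume "row X i \<noteq> 0\<^sub>v k"
    moreover have "dim_row \<Sigma> = k"
      unfolding covariance[symmetric] cov_mat_def by simp
    ultimately have "row X i \<bullet> (\<Sigma> *\<^sub>v row X i) > 0"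
      using pos_def X i by (auto simp: pos_def_mat_def)
    then have "(\<integral>\<omega>. (row X i \<bullet> W \<omega>)\<^sup>2 \<partial>\<Omega>) > 0"
      using X i by (subst expected_square) auto
    moreover have "AE \<omega> in \<Omega>. (row X i \<bullet> W \<omega>)\<^sup>2 = 0"
      using ae
    proof eventually_elim
      case (elim \<omega>)
      have "(X *\<^sub>v W \<omega>) $ i = 0" using elim i by simp
      then show ?case using X i by simp
    qed
    then have "(\<integral>\<omega>. (row X i \<bullet> W \<omega>)\<^sup>2 \<partial>\<Omega>) = 0"
      by (rule integral_eq_zero_AE)
    ultimately show False by simp
  qed
  then show ?thesis
    using X by (intro eq_rowI) auto
qed

text \<open>The integrand is nonnegative, so a zero integral makes \<open>X W\<close> vanish almost
  surely. Positivity is assumed in the bare form in which it is later extracted for diagonal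
  blocks.\<close>

lemma expected_form_nonneg:
  assumes H: "H \<in> carrier_mat m m" and X: "X \<in> carrier_mat m k"
    and pos: "\<And>a. a \<in> carrier_vec m \<Longrightarrow> a \<noteq> 0\<^sub>v m \<Longrightarrow> a \<bullet> (H *\<^sub>v a) > 0"
  shows "expected_form H X X \<ge> 0"
    and "expected_form H X X = 0 \<Longrightarrow> X = 0\<^sub>m m k"
proof -
  have nonneg: "a \<bullet> (H *\<^sub>v a) \<ge> 0" if "a \<in> carrier_vec m" for a
    using pos[OF that] H that by (cases "a = 0\<^sub>v m") (auto intro: less_imp_le)
  have car: "X *\<^sub>v W \<omega> \<in> carrier_vec m" if "\<omega> \<in> space \<Omega>" for \<omega>
    using X W_carrier[OF that] by auto
  show "expected_form H X X \<ge> 0"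
    unfolding expected_form_def by (intro Bochner_Integration.integral_nonneg nonneg car)
  assume "expected_form H X X = 0"
  then have "AE \<omega> in \<Omega>. (X *\<^sub>v W \<omega>) \<bullet> (H *\<^sub>v (X *\<^sub>v W \<omega>)) = 0"
    unfolding expected_form_def
    using integral_nonneg_eq_0_iff_AE[OF integrable_form[OF H X X]] nonneg car by auto
  then have "AE \<omega> in \<Omega>. X *\<^sub>v W \<omega> = 0\<^sub>v m"
    using AE_space
  proof eventually_elim
    case (elim \<omega>)
    then show ?case using pos[OF car[of \<omega>]] by force
  qed
  then show "X = 0\<^sub>m m k"
    by (rule zero_image_imp_zero[OF X])
qed

end

section \<open>Stacked dynamics\<close>

lemma div_mult_less: "i < n * p \<Longrightarrow> i div n < p" for i n p :: nat
  by (simp add: less_mult_imp_div_less mult.commute)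

lemma block_index_less:
  fixes t p l b :: nat
  assumes "t < p" and "l < b"
  shows "t * b + l < b * p"
proof -
  have "t * b + l < Suc t * b"
    using assms(2) by simp
  also have "\<dots> \<le> p * b"
    using assms(1) by (intro mult_le_mono1) simp
  finally show ?thesis
    by (simp add: mult.commute)
qed

lemma diag_block_replicate_carrier:
  "B \<in> carrier_mat a b \<Longrightarrow> diag_block_mat (replicate p B) \<in> carrier_mat (a * p) (b * p)"
  by (intro carrier_matI) (simp_all add: dim_diag_block_mat sum_list_replicate mult.commute)

text \<open>Index \<open>i\<close> addresses position \<open>i mod a\<close> in block
  \<open>i div a\<close>. Peeling off the first block lowers the block index by one, which drives
  the induction.\<close>

lemma diag_block_replicate_mult_vec:
  assumes B: "B \<in> carrier_mat a b" and x: "x \<in> carrier_vec (b * p)" and i: "i < a * p"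
  shows "(diag_block_mat (replicate p B) *\<^sub>v x) $ i = (B *\<^sub>v vec_block b x (i div a)) $ (i mod a)"
  using x i
proof (induction p arbitrary: x i)
  case (Suc p)
  define y z where "y = vec b (\<lambda>i. x $ i)" and "z = vec (b * p) (\<lambda>i. x $ (b + i))"
  have yz: "y \<in> carrier_vec b" "z \<in> carrier_vec (b * p)" and x: "x = y @\<^sub>v z"
    using Suc.prems(1) by (auto simp: y_def z_def intro!: eq_vecI)
  define D where "D = diag_block_mat (replicate p B)"
  have D: "D \<in> carrier_mat (a * p) (b * p)"
    unfolding D_def by (rule diag_block_replicate_carrier[OF B])
  have "diag_block_mat (replicate (Suc p) B)
      = four_block_mat B (0\<^sub>m a (b * p)) (0\<^sub>m (a * p) b) D"
    using B D by (simp add: Let_def D_def[symmetric])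
  then have "diag_block_mat (replicate (Suc p) B) *\<^sub>v x
      = (B *\<^sub>v y + 0\<^sub>m a (b * p) *\<^sub>v z) @\<^sub>v (0\<^sub>m (a * p) b *\<^sub>v y + D *\<^sub>v z)"
    using four_block_mat_mult_vec[OF B zero_carrier_mat zero_carrier_mat D yz] x by simp
  also have "B *\<^sub>v y + 0\<^sub>m a (b * p) *\<^sub>v z = B *\<^sub>v y"
    using B yz by (intro eq_vecI) auto
  also have "0\<^sub>m (a * p) b *\<^sub>v y + D *\<^sub>v z = D *\<^sub>v z"
    using D yz by (intro eq_vecI) auto
  finally have eq: "diag_block_mat (replicate (Suc p) B) *\<^sub>v x = (B *\<^sub>v y) @\<^sub>v (D *\<^sub>v z)" .
  show ?case
  proof (cases "i < a")
    case True
    have "vec_block b x (i div a) = y"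
      using True by (simp add: vec_block_def y_def)
    then show ?thesis
      using True B D yz Suc.prems(2) unfolding eq by simp
  next
    case False
    then have a: "a > 0" and i': "i - a < a * p"
      using Suc.prems(2) by (cases a; auto simp: algebra_simps)+
    have div: "i div a = Suc ((i - a) div a)" "i mod a = (i - a) mod a"
      using False a by (auto simp: le_div_geq le_mod_geq)
    have "(i - a) div a < p"
      using i' by (rule div_mult_less)
    then have "(i - a) div a * b + l < b * p" if "l < b" for l
      using that by (intro block_index_less)
    then have "vec_block b z ((i - a) div a) = vec_block b x (i div a)"
      using div by (auto simp: vec_block_def z_def algebra_simps intro!: eq_vecI)
    then show ?thesis
      using Suc.IH[OF yz(2) i'] False B D yz Suc.prems(2) div unfolding eq D_def[symmetric]
      by (simp del: index_mult_mat_vec)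
  qed
qed simp

lemma vec_add_eq_imp_diff_eq:
  fixes x y z :: "real Matrix.vec"
  assumes "x = y + z" and "y \<in> carrier_vec k" and "z \<in> carrier_vec k"
  shows "x - z = y"
  unfolding assms(1) using assms(2,3) by (intro eq_vecI) auto

lemma block_shift_carrier [simp]: "block_shift n N \<in> carrier_mat (n * (N + 1)) (n * (N + 1))"
  by (simp add: block_shift_def)

lemma block_shift_dim [simp]:
  "dim_row (block_shift n N) = n * (N + 1)" "dim_col (block_shift n N) = n * (N + 1)"
  by (simp_all add: block_shift_def)

lemma block_shift_mult_vec:
  assumes "x \<in> carrier_vec (n * (N + 1))" and "i < n * (N + 1)"
  shows "(block_shift n N *\<^sub>v x) $ i = (if i < n then 0 else x $ (i - n))"
proof -
  have "(block_shift n N *\<^sub>v x) $ i = (\<Sum>j<n * (N + 1). (if i = j + n then 1 else 0) * x $ j)"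
    using assms by (simp add: block_shift_def scalar_prod_def lessThan_atLeast0)
  also have "\<dots> = (\<Sum>j<n * (N + 1). if j = i - n \<and> n \<le> i then x $ j else 0)"
    by (intro sum.cong) auto
  also have "\<dots> = (if i < n then 0 else x $ (i - n))"
    using assms(2) by (auto simp: sum.delta)
  finally show ?thesis .
qed

lemma stack_A_carrier [simp]: "A \<in> carrier_mat n n \<Longrightarrow> stack_A N A \<in> carrier_mat (n * (N + 1)) (n * (N + 1))"
  unfolding stack_A_def by (rule diag_block_replicate_carrier)

lemma stack_B_carrier [simp]:
  "B \<in> carrier_mat n m \<Longrightarrow> stack_B n m N B \<in> carrier_mat (n * (N + 1)) (m * N)"
  unfolding stack_B_def
  using carrier_append_rows[OF diag_block_replicate_carrier[of B n m N] zero_carrier_mat[of n "m * N"]]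
  by (simp add: algebra_simps)

text \<open>The bound \<open>n * N\<close> leaves out the zero rows at the bottom. Behind the block
  shift only rows \<open>i - n\<close> with \<open>i < n * (N + 1)\<close> are read, so these rows
  suffice.\<close>

lemma stack_B_mult_vec:
  assumes B: "B \<in> carrier_mat n m" and x: "x \<in> carrier_vec (m * N)" and i: "i < n * N"
  shows "(stack_B n m N B *\<^sub>v x) $ i = (B *\<^sub>v vec_block m x (i div n)) $ (i mod n)"
proof -
  have "stack_B n m N B *\<^sub>v x
      = (diag_block_mat (replicate N B) *\<^sub>v x) @\<^sub>v (0\<^sub>m n (m * N) *\<^sub>v x)"
    unfolding stack_B_def
    by (rule mat_mult_append[OF diag_block_replicate_carrier[OF B] zero_carrier_mat x])
  then have "(stack_B n m N B *\<^sub>v x) $ i = (diag_block_mat (replicate N B) *\<^sub>v x) $ i"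
    using i diag_block_replicate_carrier[OF B, of N] by (simp del: index_mult_mat_vec)
  then show ?thesis
    using diag_block_replicate_mult_vec[OF B x i] by simp
qed

lemma stack_A_mult_vec:
  assumes "A \<in> carrier_mat n n" and "x \<in> carrier_vec (n * (N + 1))" and "i < n * (N + 1)"
  shows "(stack_A N A *\<^sub>v x) $ i = (A *\<^sub>v vec_block n x (i div n)) $ (i mod n)"
  unfolding stack_A_def using assms by (rule diag_block_replicate_mult_vec)

section \<open>Causality as strict lower triangularity\<close>

definition strictly_lower :: "real mat \<Rightarrow> bool" where
  "strictly_lower X \<longleftrightarrow> (\<forall>i j. i \<le> j \<longrightarrow> j < dim_col X \<longrightarrow> i < dim_row X \<longrightarrow> X $$ (i, j) = 0)"

text \<open>Strictness leaves ones on the diagonal. Both \<open>1 - Z A\<close> and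
  \<open>1 - P K\<close> are inverted through this.\<close>

lemma det_one_minus_strictly_lower:
  assumes X: "X \<in> carrier_mat k k" and "strictly_lower X"
  shows "det (1\<^sub>m k - X) = 1"
proof -
  have "det (1\<^sub>m k - X) = prod_list (diag_mat (1\<^sub>m k - X))"
    using assms by (intro det_lower_triangular[OF _ minus_carrier_mat[OF X]]) (auto simp: strictly_lower_def)
  also have "diag_mat (1\<^sub>m k - X) = replicate k 1"
    using assms by (intro nth_equalityI) (auto simp: diag_mat_def strictly_lower_def)
  finally show ?thesis by simp
qed

lemma strictly_lower_add:
  "X \<in> carrier_mat k l \<Longrightarrow> Y \<in> carrier_mat k l \<Longrightarrow> strictly_lower X \<Longrightarrow> strictly_lower Y \<Longrightarrow>
    strictly_lower (X + Y)"
  by (auto simp: strictly_lower_def)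

lemma index_mult_mat_col:
  fixes X Y :: "real mat"
  assumes "i < dim_row X" and "j < dim_col Y"
  shows "(X * Y) $$ (i, j) = (X *\<^sub>v col Y j) $ i"
  using assms by simp

lemma col_mult_mat_vec:
  fixes X Y :: "real mat"
  assumes "j < dim_col Y" and "dim_col X = dim_row Y"
  shows "col (X * Y) j = X *\<^sub>v col Y j"
  using assms by (intro eq_vecI) auto

lemma index_mult_zero_vec:
  fixes X :: "real mat"
  assumes "X \<in> carrier_mat k l" and "i < k"
  shows "(X *\<^sub>v 0\<^sub>v l) $ i = 0"
  using assms row_carrier_vec[OF assms(2,1)] by simp

lemma strictly_lower_shift_A:
  assumes n: "n > 0" and A: "A \<in> carrier_mat n n"
  shows "strictly_lower (block_shift n N * stack_A N A)"
  unfolding strictly_lower_def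
proof (intro allI impI)
  let ?k = "n * (N + 1)"
  fix i j assume ij: "i \<le> j" "j < dim_col (block_shift n N * stack_A N A)"
    "i < dim_row (block_shift n N * stack_A N A)"
  then have j: "j < ?k" and i: "i < ?k"
    using A carrier_matD[OF stack_A_carrier[OF A, of N]] carrier_matD[OF block_shift_carrier[of n N]] by auto
  have car: "stack_A N A *\<^sub>v unit_vec ?k j \<in> carrier_vec ?k"
    by (rule mult_mat_vec_carrier[OF stack_A_carrier[OF A] unit_vec_carrier])
  have "col (stack_A N A) j = stack_A N A *\<^sub>v unit_vec ?k j"
    using carrier_matD[OF stack_A_carrier[OF A, of N]] j
    by (intro eq_vecI) (auto simp: scalar_prod_right_unit)
  then have "(block_shift n N * stack_A N A) $$ (i, j)
      = (block_shift n N *\<^sub>v (stack_A N A *\<^sub>v unit_vec ?k j)) $ i"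
    using ij by (subst index_mult_mat_col) auto
  also have "\<dots> = 0"
  proof (cases "i < n")
    case False
    \<comment> \<open>The shift lowers the row block by exactly one, which turns
      \<open>i \<le> j\<close> into a strict inequality of block indices; the block diagonal
      \<open>stack_A\<close> is zero there.\<close>
    then have "(i - n) div n < j div n"
      using n ij(1) by (metis Suc_le_eq le_div_geq div_le_mono leI)
    then have "vec_block n (unit_vec ?k j) ((i - n) div n) = 0\<^sub>v n"
    proof -
      have "(i - n) div n * n + l \<noteq> j" if "l < n" for l
        using \<open>(i - n) div n < j div n\<close> that by auto
      then show ?thesis
        using block_index_less[of "(i - n) div n" "N + 1" _ n] div_mult_less[of "i - n" n "N + 1"] i
        by (auto simp: vec_block_def unit_vec_def intro!: eq_vecI)
    qed
    then show ?thesis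
      using block_shift_mult_vec[OF car i] False stack_A_mult_vec[OF A, of "unit_vec ?k j" N "i - n"] i
        index_mult_zero_vec[OF A mod_less_divisor[OF n]]
      by (simp add: less_imp_diff_less del: index_mult_mat_vec)
  qed (use block_shift_mult_vec[OF car i] in simp)
  finally show "(block_shift n N * stack_A N A) $$ (i, j) = 0" .
qed

text \<open>Causality still permits use of the present state, that is, blocks with
  \<open>s = t\<close>; the shift by one block makes the relation strict. \<open>K\<close> itself is
  rectangular with row blocks of size \<open>m\<close>, so triangularity appears only after
  \<open>stack_B\<close> has turned input blocks into state blocks. Strictness by blocks implies the
  entrywise strictness of \<open>strictly_lower\<close>.\<close>

lemma strictly_lower_shift_B:
  assumes n: "n > 0" and B: "B \<in> carrier_mat n m" and S: "info_structure n m N S"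
    and causal: "causal n m N S" and K: "K \<in> gains S"
  shows "strictly_lower (block_shift n N * (stack_B n m N B * K))"
  unfolding strictly_lower_def
proof (intro allI impI)
  let ?k = "n * (N + 1)"
  have Kc: "K \<in> carrier_mat (m * N) ?k"
    using gains_carrier[OF _ K] S by (auto simp: info_structure_def)
  have BK: "stack_B n m N B * K \<in> carrier_mat ?k ?k"
    by (rule mult_carrier_mat[OF stack_B_carrier[OF B] Kc])
  fix i j assume ij: "i \<le> j" "j < dim_col (block_shift n N * (stack_B n m N B * K))"
    "i < dim_row (block_shift n N * (stack_B n m N B * K))"
  then have j: "j < ?k" and i: "i < ?k"
    using carrier_matD[OF BK] carrier_matD[OF block_shift_carrier[of n N]] by auto
  have colK: "col K j \<in> carrier_vec (m * N)"
    using Kc by (simp add: carrier_vecI)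
  have car: "stack_B n m N B *\<^sub>v col K j \<in> carrier_vec ?k"
    by (rule mult_mat_vec_carrier[OF stack_B_carrier[OF B] colK])
  have "col (stack_B n m N B * K) j = stack_B n m N B *\<^sub>v col K j"
    using Kc carrier_matD[OF stack_B_carrier[OF B, of N]] j by (intro col_mult_mat_vec) auto
  then have "(block_shift n N * (stack_B n m N B * K)) $$ (i, j)
      = (block_shift n N *\<^sub>v (stack_B n m N B *\<^sub>v col K j)) $ i"
    using ij by (subst index_mult_mat_col) auto
  also have "\<dots> = 0"
  proof (cases "i < n")
    case False
    let ?t = "(i - n) div n"
    have less: "?t < j div n"
      using False n ij(1) by (metis Suc_le_eq le_div_geq div_le_mono leI)
    \<comment> \<open>This row lies above the zero rows of \<open>stack_B\<close>, so
      \<open>?t\<close> is a time below \<open>N\<close>, to which \<open>causal\<close>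
      applies.\<close>
    have i': "i - n < n * N"
      using i False by auto
    then have t: "?t < N"
      by (rule div_mult_less)
    have s: "j div n \<le> N"
      using div_mult_less[OF j] by simp
    have "K $$ (?t * m + l, j) = 0" if "l < m" for l
    proof -
      have "K $$ (?t * m + l, j div n * n + j mod n) = 0"
        using causal K t s less that mod_less_divisor[OF n] unfolding causal_def by blast
      then show ?thesis by simp
    qed
    moreover have "?t * m + l < m * N" if "l < m" for l
      using t that by (rule block_index_less)
    ultimately have "vec_block m (col K j) ?t = 0\<^sub>v m"
      using Kc j by (auto simp: vec_block_def intro!: eq_vecI)
    then show ?thesis
      using block_shift_mult_vec[OF car i] False stack_B_mult_vec[OF B colK i']
        index_mult_zero_vec[OF B mod_less_divisor[OF n]]
      by (simp del: index_mult_mat_vec)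
  qed (use block_shift_mult_vec[OF car i] in simp)
  finally show "(block_shift n N * (stack_B n m N B * K)) $$ (i, j) = 0" .
qed

lemma P_dist_inverse:
  assumes n: "n > 0" and A: "A \<in> carrier_mat n n"
  shows "P_dist n N A \<in> carrier_mat (n * (N + 1)) (n * (N + 1))"
    and "(1\<^sub>m (n * (N + 1)) - block_shift n N * stack_A N A) * P_dist n N A = 1\<^sub>m (n * (N + 1))"
    and "P_dist n N A * (1\<^sub>m (n * (N + 1)) - block_shift n N * stack_A N A) = 1\<^sub>m (n * (N + 1))"
proof -
  have ZA: "block_shift n N * stack_A N A \<in> carrier_mat (n * (N + 1)) (n * (N + 1))"
    by (rule mult_carrier_mat[OF block_shift_carrier stack_A_carrier[OF A]])
  then have "1\<^sub>m (n * (N + 1)) - block_shift n N * stack_A N A \<in> carrier_mat (n * (N + 1)) (n * (N + 1))"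
    by (rule minus_carrier_mat)
  moreover have "det (1\<^sub>m (n * (N + 1)) - block_shift n N * stack_A N A) \<noteq> 0"
    using det_one_minus_strictly_lower[OF ZA strictly_lower_shift_A[OF n A]] by simp
  ultimately show "P_dist n N A \<in> carrier_mat (n * (N + 1)) (n * (N + 1))"
    "(1\<^sub>m (n * (N + 1)) - block_shift n N * stack_A N A) * P_dist n N A = 1\<^sub>m (n * (N + 1))"
    "P_dist n N A * (1\<^sub>m (n * (N + 1)) - block_shift n N * stack_A N A) = 1\<^sub>m (n * (N + 1))"
    unfolding P_dist_def by (fact invertible_mat_inv)+
qed

lemma P_input_carrier:
  assumes "n > 0" and "A \<in> carrier_mat n n" and "B \<in> carrier_mat n m"
  shows "P_input n m N A B \<in> carrier_mat (n * (N + 1)) (m * N)"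
  unfolding P_input_def
  by (rule mult_carrier_mat[OF mult_carrier_mat[OF P_dist_inverse(1)[OF assms(1,2)] block_shift_carrier]
        stack_B_carrier[OF assms(3)]])

section \<open>Closed form of the trajectory\<close>

lemma state_carrier:
  "state n m1 m2 A B1 B2 u v w t \<in> carrier_vec n"
  by (intro carrier_vecI, cases t) (simp_all add: vec_block_def)

text \<open>The recursion is the fixed point equation \<open>x = w + Z (A x + B1 u + B2 v)\<close>
  read block by block; inverting \<open>1 - Z A\<close> solves it.\<close>

lemma trajectory_eq:
  assumes n: "n > 0" and A: "A \<in> carrier_mat n n"
    and B1: "B1 \<in> carrier_mat n m1" and B2: "B2 \<in> carrier_mat n m2"
    and u: "u \<in> carrier_vec (m1 * N)" and v: "v \<in> carrier_vec (m2 * N)"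
    and w: "w \<in> carrier_vec (n * (N + 1))"
  shows "trajectory n m1 m2 N A B1 B2 u v w
    = P_dist n N A *\<^sub>v w + P_input n m1 N A B1 *\<^sub>v u + P_input n m2 N A B2 *\<^sub>v v"
proof -
  let ?k = "n * (N + 1)" and ?Z = "block_shift n N"
  define x where "x = trajectory n m1 m2 N A B1 B2 u v w"
  have x: "x \<in> carrier_vec ?k"
    by (simp add: x_def trajectory_def)
  note ZA = mult_carrier_mat[OF block_shift_carrier[of n N] stack_A_carrier[OF A, of N]]
  have Ax: "stack_A N A *\<^sub>v x \<in> carrier_vec ?k"
    by (rule mult_mat_vec_carrier[OF stack_A_carrier[OF A] x])
  have B1u: "stack_B n m1 N B1 *\<^sub>v u \<in> carrier_vec ?k" and B2v: "stack_B n m2 N B2 *\<^sub>v v \<in> carrier_vec ?k"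
    by (rule mult_mat_vec_carrier[OF stack_B_carrier[OF B1] u]
        mult_mat_vec_carrier[OF stack_B_carrier[OF B2] v])+
  note Pd = P_dist_inverse(1)[OF n A, of N]
  have P_input_mult_vec: "P_input n m N A B *\<^sub>v a = P_dist n N A *\<^sub>v (?Z *\<^sub>v (stack_B n m N B *\<^sub>v a))"
    if B: "B \<in> carrier_mat n m" and a: "a \<in> carrier_vec (m * N)" for m B a
    unfolding P_input_def
      assoc_mult_mat_vec[OF mult_carrier_mat[OF Pd block_shift_carrier] stack_B_carrier[OF B] a]
    by (rule assoc_mult_mat_vec[OF Pd block_shift_carrier mult_mat_vec_carrier[OF stack_B_carrier[OF B] a]])
  define y where "y = w + ?Z *\<^sub>v (stack_B n m1 N B1 *\<^sub>v u) + ?Z *\<^sub>v (stack_B n m2 N B2 *\<^sub>v v)"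
  have Zc: "?Z *\<^sub>v a \<in> carrier_vec ?k" if "a \<in> carrier_vec ?k" for a
    by (rule mult_mat_vec_carrier[OF block_shift_carrier that])
  have block: "vec_block n x t = state n m1 m2 A B1 B2 u v w t" if "t \<le> N" for t
  proof -
    have "t * n + l < n * (N + 1)" if "l < n" for l
      using that \<open>t \<le> N\<close> by (intro block_index_less) simp_all
    then show ?thesis
      using state_carrier[of n m1 m2 A B1 B2 u v w t]
      by (auto simp: vec_block_def x_def trajectory_def intro!: eq_vecI)
  qed
  \<comment> \<open>In block 0 the shifted terms vanish and the initial state remains; block
    \<open>t + 1\<close> reads block \<open>t\<close> of the vectors before the shift, which is one
    step of the recursion.\<close>
  have fix_point: "x = y + ?Z *\<^sub>v (stack_A N A *\<^sub>v x)"
  proof (rule eq_vecI)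
    fix i assume "i < dim_vec (y + ?Z *\<^sub>v (stack_A N A *\<^sub>v x))"
    then have i: "i < ?k"
      by (simp add: block_shift_def)
    have wk: "vec_block n w (i div n) $ (i mod n) = w $ i"
      using n by (simp add: vec_block_def)
    have idx: "(y + ?Z *\<^sub>v (stack_A N A *\<^sub>v x)) $ i = w $ i + (?Z *\<^sub>v (stack_B n m1 N B1 *\<^sub>v u)) $ i
        + (?Z *\<^sub>v (stack_B n m2 N B2 *\<^sub>v v)) $ i + (?Z *\<^sub>v (stack_A N A *\<^sub>v x)) $ i"
      using i w by (simp add: y_def del: index_mult_mat_vec)
    show "x $ i = (y + ?Z *\<^sub>v (stack_A N A *\<^sub>v x)) $ i"
    proof (cases "i < n")
      case True
      then have "x $ i = w $ i"
        using i wk by (simp add: x_def trajectory_def)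
      then show ?thesis
        unfolding idx using True i block_shift_mult_vec[OF Ax i] block_shift_mult_vec[OF B1u i] block_shift_mult_vec[OF B2v i]
        by (simp del: index_mult_mat_vec)
    next
      case False
      let ?t = "(i - n) div n"
      have div: "i div n = Suc ?t" "i mod n = (i - n) mod n"
        using False n by (auto simp: le_div_geq le_mod_geq)
      have i': "i - n < n * N"
        using i False by auto
      have t: "?t < N"
        using i' by (rule div_mult_less)
      have "x $ i = state n m1 m2 A B1 B2 u v w (Suc ?t) $ (i mod n)"
        using i by (simp add: x_def trajectory_def div(1))
      also have "\<dots> = (A *\<^sub>v vec_block n x ?t) $ ((i - n) mod n) + (B1 *\<^sub>v vec_block m1 u ?t) $ ((i - n) mod n)
          + (B2 *\<^sub>v vec_block m2 v ?t) $ ((i - n) mod n) + w $ i"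
        using A B1 B2 n t div wk block[of ?t] by (simp add: vec_block_def)
      also have "\<dots> = w $ i + (?Z *\<^sub>v (stack_B n m1 N B1 *\<^sub>v u)) $ i
          + (?Z *\<^sub>v (stack_B n m2 N B2 *\<^sub>v v)) $ i + (?Z *\<^sub>v (stack_A N A *\<^sub>v x)) $ i"
        using False block_shift_mult_vec[OF Ax i] block_shift_mult_vec[OF B1u i]
          block_shift_mult_vec[OF B2v i] stack_A_mult_vec[OF A x, of "i - n"] i
          stack_B_mult_vec[OF B1 u i'] stack_B_mult_vec[OF B2 v i']
        by (simp add: less_imp_diff_less del: index_mult_mat_vec)
      finally show ?thesis
        by (simp only: idx)
    qed
  qed (use x in \<open>simp add: block_shift_def\<close>)
  have "y \<in> carrier_vec ?k"
    unfolding y_def by (intro add_carrier_vec w Zc B1u B2v)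
  from vec_add_eq_imp_diff_eq[OF fix_point this Zc[OF Ax]]
  have "x - ?Z *\<^sub>v (stack_A N A *\<^sub>v x) = y" .
  then have "(1\<^sub>m ?k - ?Z * stack_A N A) *\<^sub>v x = y"
    using minus_mult_distrib_mat_vec[OF one_carrier_mat ZA x]
      assoc_mult_mat_vec[OF block_shift_carrier stack_A_carrier[OF A] x] x by simp
  then have "P_dist n N A *\<^sub>v ((1\<^sub>m ?k - ?Z * stack_A N A) *\<^sub>v x) = P_dist n N A *\<^sub>v y"
    by simp
  also have "P_dist n N A *\<^sub>v ((1\<^sub>m ?k - ?Z * stack_A N A) *\<^sub>v x) = x"
    unfolding assoc_mult_mat_vec[OF Pd minus_carrier_mat[OF ZA] x, symmetric] P_dist_inverse(3)[OF n A]
    by (rule one_mult_mat_vec[OF x])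
  also have "P_dist n N A *\<^sub>v y = P_dist n N A *\<^sub>v w + P_input n m1 N A B1 *\<^sub>v u
      + P_input n m2 N A B2 *\<^sub>v v"
    unfolding y_def mult_add_distrib_mat_vec[OF Pd add_carrier_vec[OF w Zc[OF B1u]] Zc[OF B2v]]
      mult_add_distrib_mat_vec[OF Pd w Zc[OF B1u]] P_input_mult_vec[OF B1 u] P_input_mult_vec[OF B2 v] ..
  finally show ?thesis
    by (simp add: x_def)
qed

section \<open>Triangular inverses and nilpotent powers\<close>

lemma inverse_one_minus_strictly_lower:
  assumes X: "X \<in> carrier_mat k k" and lower: "strictly_lower X" and Y: "Y \<in> carrier_mat k k"
    and inv: "(1\<^sub>m k - X) * Y = 1\<^sub>m k"
  shows "i < j \<Longrightarrow> j < k \<Longrightarrow> Y $$ (i, j) = 0"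
proof (induction i rule: less_induct)
  case (less i)
  then have i: "i < k" by simp
  \<comment> \<open>Forward substitution: \<open>Y = 1 + X Y\<close>, and row \<open>i\<close> of
    \<open>X Y\<close> involves only rows \<open>l < i\<close> of \<open>Y\<close>, which the
    induction covers.\<close>
  have "(1\<^sub>m k - X) * Y = Y - X * Y"
    using carrier_matD[OF X] carrier_matD[OF Y] by (simp add: mat_distribs)
  from trans[OF this[symmetric] inv] have "(Y - X * Y) $$ (i, j) = 0"
    using less.prems i by (simp only: index_one_mat) simp
  moreover have "(X * Y) $$ (i, j) = (\<Sum>l\<in>{0..<k}. X $$ (i, l) * Y $$ (l, j))"
    using X Y i less.prems by (simp add: scalar_prod_def)
  moreover have "\<dots> = 0"
  proof (intro sum.neutral ballI)
    fix l assume "l \<in> {0..<k}"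
    then show "X $$ (i, l) * Y $$ (l, j) = 0"
      using less.IH[of l] less.prems lower X i by (cases "l < i") (auto simp: strictly_lower_def)
  qed
  ultimately show ?case
    using X Y i less.prems by (simp del: index_mult_mat(1))
qed

lemma strictly_lower_mult:
  assumes Y: "Y \<in> carrier_mat k k" and X: "X \<in> carrier_mat k k" "strictly_lower X"
    and lower: "\<And>i j. i < j \<Longrightarrow> j < k \<Longrightarrow> Y $$ (i, j) = 0"
  shows "strictly_lower (Y * X)"
  unfolding strictly_lower_def
proof (intro allI impI)
  fix i j assume ij: "i \<le> j" "j < dim_col (Y * X)" "i < dim_row (Y * X)"
  then have "(Y * X) $$ (i, j) = (\<Sum>l\<in>{0..<k}. Y $$ (i, l) * X $$ (l, j))"
    using Y X by (simp add: scalar_prod_def)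
  \<comment> \<open>For \<open>i < l\<close> the entry of \<open>Y\<close> vanishes; for
    \<open>l \<le> i \<le> j\<close> that of \<open>X\<close> does.\<close>
  also have "\<dots> = 0"
  proof (intro sum.neutral ballI)
    fix l assume "l \<in> {0..<k}"
    then show "Y $$ (i, l) * X $$ (l, j) = 0"
      using ij X Y lower[of i l] by (cases "i < l") (auto simp: strictly_lower_def)
  qed
  finally show "(Y * X) $$ (i, j) = 0" .
qed

lemma strictly_lower_nilpotent:
  assumes X: "X \<in> carrier_mat k k" and lower: "strictly_lower X"
  shows "X ^\<^sub>m k = 0\<^sub>m k k"
proof -
  have pow: "X ^\<^sub>m p \<in> carrier_mat k k" for p
    using X by simp
  \<comment> \<open>Each further factor pushes the possibly nonzero entries one diagonal down; at
    \<open>p = k\<close> none is left.\<close>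
  have "(X ^\<^sub>m p) $$ (i, j) = 0" if "i < j + p" "i < k" "j < k" for p i j
    using that
  proof (induction p arbitrary: i j)
    case (Suc p)
    have "(X ^\<^sub>m Suc p) $$ (i, j) = (\<Sum>l\<in>{0..<k}. (X ^\<^sub>m p) $$ (i, l) * X $$ (l, j))"
      using X pow[of p] Suc.prems by (simp add: scalar_prod_def)
    also have "\<dots> = 0"
    proof (intro sum.neutral ballI)
      fix l assume "l \<in> {0..<k}"
      then show "(X ^\<^sub>m p) $$ (i, l) * X $$ (l, j) = 0"
        using Suc.IH[of i l] Suc.prems X lower by (cases "i < l + p") (auto simp: strictly_lower_def)
    qed
    finally show ?case .
  qed (use X in auto)
  then show ?thesis
    using pow[of k] by (intro eq_matI) auto
qed

text \<open>The Neumann series of \<open>g_inv P K\<close> is finite, and each of its terms \<open>K (P K)^p\<close>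
  is half the Jordan product of \<open>K\<close> and the previous one.\<close>

lemma g_inv_in_gains:
  assumes S: "S \<in> carrier_mat r c" and P: "P \<in> carrier_mat c r"
    and qi: "\<And>K. K \<in> gains S \<Longrightarrow> K * P * K \<in> gains S"
    and K: "K \<in> gains S" and T: "T \<in> carrier_mat c c" and inv: "(1\<^sub>m c - P * K) * T = 1\<^sub>m c"
    and nil: "(P * K) ^\<^sub>m p = 0\<^sub>m c c"
  shows "g_inv P K \<in> gains S"
proof -
  have Kc: "K \<in> carrier_mat r c"
    using gains_carrier[OF S K] .
  have PK: "P * K \<in> carrier_mat c c"
    using P Kc by simp
  define X where "X = P * K"
  have X: "X \<in> carrier_mat c c" and pow: "X ^\<^sub>m p \<in> carrier_mat c c" for p
    using PK by (simp_all add: X_def)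
  note d = carrier_matD[OF P] carrier_matD[OF Kc] carrier_matD[OF T] carrier_matD[OF X]
    carrier_matD[OF pow]
  have car: "1\<^sub>m c - P * K \<in> carrier_mat c c"
    using PK by (rule minus_carrier_mat)
  define Q where "Q = K * T"
  have Qc: "Q \<in> carrier_mat r c"
    using Kc T by (simp add: Q_def)
  note d = d carrier_matD[OF Qc]
  have g: "g_inv P K = Q"
    using mat_inv_eqI[OF car T inv] P Kc d by (simp add: g_inv_def Q_def)
  have "T * (1\<^sub>m c - P * K) = 1\<^sub>m c"
    using mat_mult_left_right_inverse[OF car T inv] .
  then have "K * (T * (1\<^sub>m c - X)) = K"
    using d by (simp add: X_def mult_one_dim)
  then have QX: "Q - Q * X = K"
    using d unfolding Q_def by (simp add: mat_distribs)
  have comm: "X * X ^\<^sub>m q = X ^\<^sub>m q * X" for q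
  proof (induction q)
    case (Suc q)
    have "X * X ^\<^sub>m Suc q = (X * X ^\<^sub>m q) * X"
      using d by (simp add: mult_assoc_dim)
    then show ?case
      using Suc by simp
  qed (use d in \<open>simp add: mult_one_dim one_mult_dim\<close>)
  have powers: "K * X ^\<^sub>m q \<in> gains S" for q
  proof (induction q)
    case 0
    then show ?case using K d by (simp add: mult_one_dim)
  next
    case (Suc q)
    let ?Y = "K * X ^\<^sub>m q"
    have "K + ?Y \<in> gains S"
      using K Suc by (rule gains_add)
    then have "(1/2) \<cdot>\<^sub>m ((K + ?Y) * P * (K + ?Y) - K * P * K - ?Y * P * ?Y) \<in> gains S"
      using K Suc by (intro gains_smult gains_minus qi)
    also have "(K + ?Y) * P * (K + ?Y) - K * P * K - ?Y * P * ?Y = K * P * ?Y + ?Y * P * K"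
      using d by (simp add: mat_distribs)
        (intro eq_matI, auto simp del: index_mult_mat(1) simp: algebra_simps)
    also have "K * P * ?Y = K * (X * X ^\<^sub>m q)"
      using d by (simp add: X_def mult_assoc_dim)
    also have "?Y * P * K = K * (X ^\<^sub>m q * X)"
      using d by (simp add: X_def mult_assoc_dim)
    also have "(1/2) \<cdot>\<^sub>m (K * (X * X ^\<^sub>m q) + K * (X ^\<^sub>m q * X)) = K * X ^\<^sub>m Suc q"
      using d unfolding comm by (intro eq_matI) (auto simp del: index_mult_mat(1))
    finally show ?case .
  qed
  \<comment> \<open>By \<open>Q - Q X = K\<close> this difference telescopes to the partial sum
    \<open>K + K X + ... + K X^(q-1)\<close>; at \<open>q = p\<close> nilpotency leaves
    \<open>Q\<close> itself.\<close>
  have "Q - Q * X ^\<^sub>m q \<in> gains S" for q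
  proof (induction q)
    case 0
    have "Q - Q * X ^\<^sub>m 0 = 0 \<cdot>\<^sub>m K"
      using d by (intro eq_matI) (auto simp: mult_one_dim)
    then show ?case using K by (simp add: gains_smult)
  next
    case (Suc q)
    have "(Q - Q * X ^\<^sub>m q) + (Q - Q * X) * X ^\<^sub>m q \<in> gains S"
      unfolding QX using Suc powers by (rule gains_add)
    also have "(Q - Q * X ^\<^sub>m q) + (Q - Q * X) * X ^\<^sub>m q = Q - Q * X ^\<^sub>m Suc q"
      using d comm by (simp add: mat_distribs)
        (intro eq_matI, auto simp del: index_mult_mat(1))
    finally show ?case .
  qed
  from this[of p] have "Q - Q * 0\<^sub>m c c \<in> gains S"
    using nil by (simp add: X_def)
  also have "Q - Q * 0\<^sub>m c c = Q"
    using Qc by (intro eq_matI) auto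
  finally show ?thesis
    by (simp add: g)
qed

section \<open>Stacked gains\<close>

lemma index_append_rows:
  fixes X Y :: "'a :: zero mat"
  assumes "X \<in> carrier_mat r1 c" and "Y \<in> carrier_mat r2 c" and "i < r1 + r2" and "j < c"
  shows "(X @\<^sub>r Y) $$ (i, j) = (if i < r1 then X $$ (i, j) else Y $$ (i - r1, j))"
  using assms by (auto simp: append_rows_def)

lemma append_top_bottom_rows:
  assumes "X \<in> carrier_mat (r1 + r2) c"
  shows "top_rows r1 X @\<^sub>r bottom_rows r1 X = X"
  using assms by (intro eq_matI) (auto simp: append_rows_def top_rows_def bottom_rows_def)

text \<open>Turns the product of the two structures into the structure of one stacked pattern, so
  that results for a single \<open>S\<close> cover both teams at once.\<close>

lemma stacked_gains_eq:
  assumes S1: "S1 \<in> carrier_mat r1 c" and S2: "S2 \<in> carrier_mat r2 c"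
  shows "stacked_gains S1 S2 = gains (S1 @\<^sub>r S2)"
proof (intro equalityI subsetI)
  fix X assume "X \<in> stacked_gains S1 S2"
  then show "X \<in> gains (S1 @\<^sub>r S2)"
    using assms
    by (auto simp: stacked_gains_def gains_def index_append_rows[of _ r1 c _ r2]
        carrier_matD[OF carrier_append_rows[of _ r1 c _ r2]] split: if_splits)
next
  fix X assume X: "X \<in> gains (S1 @\<^sub>r S2)"
  then have Xc: "X \<in> carrier_mat (r1 + r2) c"
    using gains_carrier[OF carrier_append_rows[OF assms]] by simp
  have "S1 $$ (j, k) = 0 \<Longrightarrow> X $$ (j, k) = 0" if "j < r1" "k < c" for j k
    using X that index_append_rows[OF assms, of j k] carrier_matD[OF carrier_append_rows[OF assms]]
    by (auto simp: gains_def)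
  moreover have "S2 $$ (j, k) = 0 \<Longrightarrow> X $$ (r1 + j, k) = 0" if "j < r2" "k < c" for j k
    using X that index_append_rows[OF assms, of "r1 + j" k] carrier_matD[OF carrier_append_rows[OF assms]]
    by (auto simp: gains_def)
  ultimately have "top_rows r1 X \<in> gains S1" "bottom_rows r1 X \<in> gains S2"
    using assms Xc by (auto simp: gains_def top_rows_def bottom_rows_def)
  then show "X \<in> stacked_gains S1 S2"
    using append_top_bottom_rows[OF Xc] by (force simp: stacked_gains_def)
qed

lemma append_cols_mult_append_rows:
  assumes X: "X \<in> carrier_mat l r1" and Y: "Y \<in> carrier_mat l r2"
    and K1: "K1 \<in> carrier_mat r1 c" and K2: "K2 \<in> carrier_mat r2 c"
  shows "(X @\<^sub>c Y) * (K1 @\<^sub>r K2) = X * K1 + Y * K2"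
proof -
  have "(X @\<^sub>c Y) * (K1 @\<^sub>r K2)
    = four_block_mat (X * K1 + Y * K2) (X * 0\<^sub>m r1 0 + Y * 0\<^sub>m r2 0)
        (0\<^sub>m 0 r1 * K1 + 0\<^sub>m 0 r2 * K2) (0\<^sub>m 0 r1 * 0\<^sub>m r1 0 + 0\<^sub>m 0 r2 * 0\<^sub>m r2 0)"
    using mult_four_block_mat[OF X Y zero_carrier_mat zero_carrier_mat K1 zero_carrier_mat K2 zero_carrier_mat]
    unfolding append_cols_def append_rows_def carrier_matD[OF X] carrier_matD[OF Y]
      carrier_matD[OF K1] carrier_matD[OF K2] .
  also have "\<dots> = X * K1 + Y * K2"
    using assms by (intro eq_matI) (auto simp del: index_mult_mat(1))
  finally show ?thesis .
qed

lemma append_rows_unit_mat: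
  assumes X1: "X1 \<in> carrier_mat r1 c" and X2: "X2 \<in> carrier_mat r2 c" and "j < r1 + r2"
  shows "(X1 @\<^sub>r X2) + t \<cdot>\<^sub>m unit_mat (r1 + r2) c j k
    = (if j < r1 then (X1 + t \<cdot>\<^sub>m unit_mat r1 c j k) @\<^sub>r X2
       else X1 @\<^sub>r (X2 + t \<cdot>\<^sub>m unit_mat r2 c (j - r1) k))"
  using assms by (auto intro!: eq_matI simp: append_rows_def unit_mat_def)

text \<open>A single entry lies in the rows of exactly one team, so a step along it is a unilateral
  deviation: a minimum for rows of the first team, a maximum for rows of the second.\<close>

lemma saddle_point_unit_extremum:
  assumes saddle: "saddle_point S1 S2 F X1 X2"
    and S1: "S1 \<in> carrier_mat r1 c" and S2: "S2 \<in> carrier_mat r2 c"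
    and jk: "j < r1 + r2" "k < c" "(S1 @\<^sub>r S2) $$ (j, k) \<noteq> 0"
  shows "(\<forall>t. F (X1 @\<^sub>r X2) \<le> F ((X1 @\<^sub>r X2) + t \<cdot>\<^sub>m unit_mat (r1 + r2) c j k)) \<or>
         (\<forall>t. F ((X1 @\<^sub>r X2) + t \<cdot>\<^sub>m unit_mat (r1 + r2) c j k) \<le> F (X1 @\<^sub>r X2))"
proof -
  have X: "X1 \<in> gains S1" "X2 \<in> gains S2"
    using saddle by (auto simp: saddle_point_def)
  note step = append_rows_unit_mat[OF gains_carrier[OF S1 X(1)] gains_carrier[OF S2 X(2)] jk(1)]
  show ?thesis
  proof (cases "j < r1")
    case True
    then have "X1 + t \<cdot>\<^sub>m unit_mat r1 c j k \<in> gains S1" for t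
      using jk index_append_rows[OF S1 S2, of j k] S1 X by (intro gains_add gains_smult unit_mat_gains) auto
    then show ?thesis
      using True saddle X unfolding step by (auto simp: saddle_point_def)
  next
    case False
    then have "X2 + t \<cdot>\<^sub>m unit_mat r2 c (j - r1) k \<in> gains S2" for t
      using jk index_append_rows[OF S1 S2, of j k] S2 X by (intro gains_add gains_smult unit_mat_gains) auto
    then show ?thesis
      using False saddle X unfolding step by (auto simp: saddle_point_def)
  qed
qed

section \<open>Symmetry and definiteness of the weights\<close>

lemma diag_block_mat_symmetric:
  assumes "\<And>X. X \<in> set Xs \<Longrightarrow> X \<in> carrier_mat m m \<and> sym_mat X"
  shows "diag_block_mat Xs \<in> carrier_mat (m * length Xs) (m * length Xs) \<and> sym_mat (diag_block_mat Xs)"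
  using assms
proof (induction Xs)
  case (Cons X Xs)
  then have X: "X \<in> carrier_mat m m" "sym_mat X"
    and D: "diag_block_mat Xs \<in> carrier_mat (m * length Xs) (m * length Xs)" "sym_mat (diag_block_mat Xs)"
    by auto
  have "diag_block_mat (X # Xs)
      = four_block_mat X (0\<^sub>m m (m * length Xs)) (0\<^sub>m (m * length Xs) m) (diag_block_mat Xs)"
    using X D by (simp add: Let_def)
  moreover have "(four_block_mat X (0\<^sub>m m (m * length Xs)) (0\<^sub>m (m * length Xs) m) (diag_block_mat Xs))\<^sup>T
      = four_block_mat X (0\<^sub>m m (m * length Xs)) (0\<^sub>m (m * length Xs) m) (diag_block_mat Xs)"
    using X D by (subst transpose_four_block_mat) (auto simp: sym_mat_def)
  ultimately show ?case
    using four_block_carrier_mat[OF X(1) D(1)] by (simp add: sym_mat_def)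
qed (auto simp: sym_mat_def intro!: eq_matI)

lemma stack_M_symmetric:
  assumes "\<And>t. t \<in> {1..N} \<Longrightarrow> M t \<in> carrier_mat n n \<and> sym_mat (M t)"
  shows "stack_M n N M \<in> carrier_mat (n * (N + 1)) (n * (N + 1))" and "sym_mat (stack_M n N M)"
proof -
  have blocks: "X \<in> carrier_mat n n \<and> sym_mat X" if "X \<in> set (0\<^sub>m n n # map M [1..<N + 1])" for X
    using that assms by (auto simp: sym_mat_def simp del: upt_Suc)
  show "stack_M n N M \<in> carrier_mat (n * (N + 1)) (n * (N + 1))" "sym_mat (stack_M n N M)"
    using diag_block_mat_symmetric[of "0\<^sub>m n n # map M [1..<N + 1]" n, OF blocks]
    by (simp_all add: stack_M_def del: upt_Suc diag_block_mat.simps)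
qed

lemma stack_input_weight_symmetric:
  assumes "\<And>t. t < N \<Longrightarrow> R t \<in> carrier_mat m m \<and> sym_mat (R t)"
  shows "stack_input_weight N R \<in> carrier_mat (m * N) (m * N)" and "sym_mat (stack_input_weight N R)"
proof -
  have blocks: "X \<in> carrier_mat m m \<and> sym_mat X" if "X \<in> set (map R [0..<N])" for X
    using that assms by auto
  show "stack_input_weight N R \<in> carrier_mat (m * N) (m * N)" "sym_mat (stack_input_weight N R)"
    using diag_block_mat_symmetric[of "map R [0..<N]" m, OF blocks] by (simp_all add: stack_input_weight_def)
qed

text \<open>Vectors padded with zeros isolate the diagonal blocks. For the game this means strict
  convexity of the cost in the first team's input and strict concavity in the second's.\<close>

lemma four_block_diagonal_pos:
  assumes pd: "pos_def_mat (four_block_mat X Y Z X')"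
    and X: "X \<in> carrier_mat a a" and Y: "Y \<in> carrier_mat a b" and Z: "Z \<in> carrier_mat b a"
    and X': "X' \<in> carrier_mat b b"
  shows "\<And>x. x \<in> carrier_vec a \<Longrightarrow> x \<noteq> 0\<^sub>v a \<Longrightarrow> x \<bullet> (X *\<^sub>v x) > 0"
    and "\<And>x. x \<in> carrier_vec b \<Longrightarrow> x \<noteq> 0\<^sub>v b \<Longrightarrow> x \<bullet> (X' *\<^sub>v x) > 0"
proof -
  let ?B = "four_block_mat X Y Z X'"
  have pos: "z \<bullet> (?B *\<^sub>v z) > 0" if "z \<in> carrier_vec (a + b)" "z \<noteq> 0\<^sub>v (a + b)" for z
    using pd that X X' by (simp add: pos_def_mat_def)
  have zero: "0\<^sub>v a @\<^sub>v 0\<^sub>v b = 0\<^sub>v (a + b)"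
    by (intro eq_vecI) auto
  {
    fix x :: "real Matrix.vec" assume x: "x \<in> carrier_vec a" "x \<noteq> 0\<^sub>v a"
    have "x @\<^sub>v 0\<^sub>v b \<noteq> 0\<^sub>v (a + b)"
      using x unfolding zero[symmetric] by (subst append_vec_eq[OF x(1) zero_carrier_vec]) auto
    then have "(x @\<^sub>v 0\<^sub>v b) \<bullet> (?B *\<^sub>v (x @\<^sub>v 0\<^sub>v b)) > 0"
      using x by (intro pos) auto
    also have "?B *\<^sub>v (x @\<^sub>v 0\<^sub>v b) = (X *\<^sub>v x + Y *\<^sub>v 0\<^sub>v b) @\<^sub>v (Z *\<^sub>v x + X' *\<^sub>v 0\<^sub>v b)"
      by (rule four_block_mat_mult_vec[OF X Y Z X' x(1) zero_carrier_vec])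
    also have "(x @\<^sub>v 0\<^sub>v b) \<bullet> \<dots> = x \<bullet> (X *\<^sub>v x + Y *\<^sub>v 0\<^sub>v b) + 0\<^sub>v b \<bullet> (Z *\<^sub>v x + X' *\<^sub>v 0\<^sub>v b)"
      using x X Y Z X' by (intro scalar_prod_append[of _ a _ b]) auto
    also have "X *\<^sub>v x + Y *\<^sub>v 0\<^sub>v b = X *\<^sub>v x"
      using x X Y by (intro eq_vecI) (auto simp: index_mult_zero_vec[OF Y] simp del: index_mult_mat_vec)
    also have "0\<^sub>v b \<bullet> (Z *\<^sub>v x + X' *\<^sub>v 0\<^sub>v b) = 0"
      using x X' by (intro scalar_prod_left_zero[of _ b] add_carrier_vec mult_mat_vec_carrier[OF X'] mult_mat_vec_carrier[OF Z]) auto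
    finally show "x \<bullet> (X *\<^sub>v x) > 0"
      by simp
  }
  {
    fix x :: "real Matrix.vec" assume x: "x \<in> carrier_vec b" "x \<noteq> 0\<^sub>v b"
    have "0\<^sub>v a @\<^sub>v x \<noteq> 0\<^sub>v (a + b)"
      using x unfolding zero[symmetric] by (subst append_vec_eq[OF zero_carrier_vec zero_carrier_vec]) auto
    then have "(0\<^sub>v a @\<^sub>v x) \<bullet> (?B *\<^sub>v (0\<^sub>v a @\<^sub>v x)) > 0"
      using x by (intro pos) auto
    also have "?B *\<^sub>v (0\<^sub>v a @\<^sub>v x) = (X *\<^sub>v 0\<^sub>v a + Y *\<^sub>v x) @\<^sub>v (Z *\<^sub>v 0\<^sub>v a + X' *\<^sub>v x)"
      by (rule four_block_mat_mult_vec[OF X Y Z X' zero_carrier_vec x(1)])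
    also have "(0\<^sub>v a @\<^sub>v x) \<bullet> \<dots> = 0\<^sub>v a \<bullet> (X *\<^sub>v 0\<^sub>v a + Y *\<^sub>v x) + x \<bullet> (Z *\<^sub>v 0\<^sub>v a + X' *\<^sub>v x)"
      using x X Y Z X' by (intro scalar_prod_append[of _ a _ b]) auto
    also have "Z *\<^sub>v 0\<^sub>v a + X' *\<^sub>v x = X' *\<^sub>v x"
      using x X' Z by (intro eq_vecI) (auto simp: index_mult_zero_vec[OF Z] simp del: index_mult_mat_vec)
    also have "0\<^sub>v a \<bullet> (X *\<^sub>v 0\<^sub>v a + Y *\<^sub>v x) = 0"
      using x by (intro scalar_prod_left_zero[of _ a] add_carrier_vec mult_mat_vec_carrier[OF X] mult_mat_vec_carrier[OF Y]) auto
    finally show "x \<bullet> (X' *\<^sub>v x) > 0"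
      by simp
  }
qed

lemma P_inputs_carrier:
  assumes "n > 0" and "A \<in> carrier_mat n n" and "B1 \<in> carrier_mat n m1" and "B2 \<in> carrier_mat n m2"
  shows "P_inputs n m1 m2 N A B1 B2 \<in> carrier_mat (n * (N + 1)) (m1 * N + m2 * N)"
  using carrier_matD[OF P_input_carrier[OF assms(1,2,3), of N]]
    carrier_matD[OF P_input_carrier[OF assms(1,2,4), of N]]
  unfolding P_inputs_def append_cols_def by (intro carrier_matI) simp_all

text \<open>The product equals \<open>(1 - Z A)^(-1) (Z B1 K1 + Z B2 K2)\<close>, a lower triangular
  factor times a strictly lower one. Invertibility of \<open>1 - P K\<close> and nilpotency of
  \<open>P K\<close> both rest on this.\<close>

lemma strictly_lower_closed_loop:
  assumes n: "n > 0" and A: "A \<in> carrier_mat n n"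
    and B1: "B1 \<in> carrier_mat n m1" and B2: "B2 \<in> carrier_mat n m2"
    and S1: "info_structure n m1 N S1" "causal n m1 N S1"
    and S2: "info_structure n m2 N S2" "causal n m2 N S2"
    and K: "K \<in> stacked_gains S1 S2"
  shows "strictly_lower (P_inputs n m1 m2 N A B1 B2 * K)"
proof -
  let ?k = "n * (N + 1)"
  obtain K1 K2 where K12: "K = K1 @\<^sub>r K2" "K1 \<in> gains S1" "K2 \<in> gains S2"
    using K by (auto simp: stacked_gains_def)
  have S: "S1 \<in> carrier_mat (m1 * N) ?k" "S2 \<in> carrier_mat (m2 * N) ?k"
    using S1(1) S2(1) by (auto simp: info_structure_def)
  note K1 = gains_carrier[OF S(1) K12(2)] and K2 = gains_carrier[OF S(2) K12(3)]
  note Pd = P_dist_inverse[OF n A, of N]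
  define Y1 Y2 where "Y1 = block_shift n N * (stack_B n m1 N B1 * K1)"
    and "Y2 = block_shift n N * (stack_B n m2 N B2 * K2)"
  have Y: "Y1 \<in> carrier_mat ?k ?k" "Y2 \<in> carrier_mat ?k ?k"
    unfolding Y1_def Y2_def
    by (rule mult_carrier_mat[OF block_shift_carrier mult_carrier_mat[OF stack_B_carrier[OF B1] K1]]
        mult_carrier_mat[OF block_shift_carrier mult_carrier_mat[OF stack_B_carrier[OF B2] K2]])+
  have lower: "strictly_lower (Y1 + Y2)"
    using strictly_lower_shift_B[OF n B1 S1 K12(2)] strictly_lower_shift_B[OF n B2 S2 K12(3)]
    unfolding Y1_def[symmetric] Y2_def[symmetric] by (rule strictly_lower_add[OF Y])
  have "P_inputs n m1 m2 N A B1 B2 * K = P_input n m1 N A B1 * K1 + P_input n m2 N A B2 * K2"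
    unfolding P_inputs_def K12(1)
    by (rule append_cols_mult_append_rows[OF P_input_carrier[OF n A B1] P_input_carrier[OF n A B2] K1 K2])
  also have "\<dots> = P_dist n N A * (Y1 + Y2)"
    unfolding P_input_def Y1_def Y2_def
    using carrier_matD[OF Pd(1)] carrier_matD[OF stack_B_carrier[OF B1, of N]]
      carrier_matD[OF stack_B_carrier[OF B2, of N]] carrier_matD[OF K1] carrier_matD[OF K2]
    by (simp add: mat_distribs)
  finally have eq: "P_inputs n m1 m2 N A B1 B2 * K = P_dist n N A * (Y1 + Y2)" .
  show ?thesis
    unfolding eq
    using inverse_one_minus_strictly_lower[OF mult_carrier_mat[OF block_shift_carrier stack_A_carrier[OF A]]
        strictly_lower_shift_A[OF n A] Pd(1,2)]
    by (intro strictly_lower_mult[OF Pd(1) add_carrier_mat[OF Y(2)] lower])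
qed

section \<open>The team game\<close>

lemma top_rows_carrier: "X \<in> carrier_mat r c \<Longrightarrow> top_rows k X \<in> carrier_mat k c"
  and bottom_rows_carrier: "Y \<in> carrier_mat (k + l) c \<Longrightarrow> bottom_rows k Y \<in> carrier_mat l c"
  by (auto simp: top_rows_def bottom_rows_def)

lemma top_rows_linear:
  assumes "X \<in> carrier_mat (k + l) c" and "Y \<in> carrier_mat (k + l) c"
  shows "top_rows k (X + a \<cdot>\<^sub>m Y) = top_rows k X + a \<cdot>\<^sub>m top_rows k Y"
    and "bottom_rows k (X + a \<cdot>\<^sub>m Y) = bottom_rows k X + a \<cdot>\<^sub>m bottom_rows k Y"
  using assms by (auto simp: top_rows_def bottom_rows_def intro!: eq_matI)

locale team_game = gaussian_noise \<Omega> "n * (N + 1)" W \<Sigma>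
  for \<Omega> :: "'w measure" and n N :: nat and W \<Sigma> +
  fixes m1 m2 :: nat and A B1 B2 :: "real mat" and M R V :: "nat \<Rightarrow> real mat"
  assumes n: "n > 0"
    and A: "A \<in> carrier_mat n n" and B1: "B1 \<in> carrier_mat n m1" and B2: "B2 \<in> carrier_mat n m2"
    and M: "\<And>t. t \<in> {1..N} \<Longrightarrow> M t \<in> carrier_mat n n \<and> sym_mat (M t)"
    and R: "\<And>t. t < N \<Longrightarrow> R t \<in> carrier_mat m1 m1 \<and> sym_mat (R t)"
    and V: "\<And>t. t < N \<Longrightarrow> V t \<in> carrier_mat m2 m2 \<and> sym_mat (V t)"
    and pos_def_cost: "pos_def_mat (four_block_mat
           ((P_input n m1 N A B1)\<^sup>T * stack_M n N M * P_input n m1 N A B1 + stack_input_weight N R)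
           ((P_input n m1 N A B1)\<^sup>T * stack_M n N M * P_input n m2 N A B2)
           ((P_input n m2 N A B2)\<^sup>T * stack_M n N M * P_input n m1 N A B1)
           (- ((P_input n m2 N A B2)\<^sup>T * stack_M n N M * P_input n m2 N A B2
               + stack_input_weight N V)))"
begin

abbreviation "k \<equiv> n * (N + 1)"
abbreviation "r1 \<equiv> m1 * N"
abbreviation "r2 \<equiv> m2 * N"
abbreviation "Pd \<equiv> P_dist n N A"
abbreviation "P1 \<equiv> P_input n m1 N A B1"
abbreviation "P2 \<equiv> P_input n m2 N A B2"
abbreviation "Mw \<equiv> stack_M n N M"
abbreviation "Rw \<equiv> stack_input_weight N R"
abbreviation "Vw \<equiv> stack_input_weight N V"
abbreviation "cost \<equiv> feedforward_cost \<Omega> W n m1 m2 N A B1 B2 M R V"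

lemmas Pd = P_dist_inverse[OF n A, of N]
lemmas P1 = P_input_carrier[OF n A B1, of N]
lemmas P2 = P_input_carrier[OF n A B2, of N]
lemmas Mw = stack_M_symmetric[of N M n, OF M]
lemmas Rw = stack_input_weight_symmetric[of N R m1, OF R]
lemmas Vw = stack_input_weight_symmetric[of N V m2, OF V]

section \<open>The cost as a quadratic polynomial in the stacked gain\<close>

definition u_gain :: "real mat \<Rightarrow> real mat" where
  "u_gain Q = top_rows r1 Q * Pd"

definition v_gain :: "real mat \<Rightarrow> real mat" where
  "v_gain Q = bottom_rows r1 Q * Pd"

text \<open>The part of the state due to the inputs: the state is \<open>Pd + input_gain Q\<close>
  applied to the noise, hence affine in \<open>Q\<close>.\<close>

definition input_gain :: "real mat \<Rightarrow> real mat" where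
  "input_gain Q = P1 * u_gain Q + P2 * v_gain Q"

text \<open>The derivative of the cost at \<open>Q\<close> in direction \<open>D\<close>; the factor
  2 comes from differentiating squares.\<close>

definition cost_gradient :: "real mat \<Rightarrow> real mat \<Rightarrow> real" where
  "cost_gradient Q D = 2 * (expected_form Mw (Pd + input_gain Q) (input_gain D)
     + expected_form Rw (u_gain Q) (u_gain D) + expected_form Vw (v_gain Q) (v_gain D))"

text \<open>Half the second derivative, which is independent of the base point. It keeps two
  arguments because it will be evaluated at a direction and its partly negated copy.\<close>

definition cost_hessian :: "real mat \<Rightarrow> real mat \<Rightarrow> real" where
  "cost_hessian D E = expected_form Mw (input_gain D) (input_gain E)
     + expected_form Rw (u_gain D) (u_gain E) + expected_form Vw (v_gain D) (v_gain E)"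

lemma gain_carrier:
  assumes "Q \<in> carrier_mat (r1 + r2) k"
  shows "u_gain Q \<in> carrier_mat r1 k" and "v_gain Q \<in> carrier_mat r2 k"
    and "input_gain Q \<in> carrier_mat k k"
proof -
  show u: "u_gain Q \<in> carrier_mat r1 k"
    unfolding u_gain_def by (rule mult_carrier_mat[OF top_rows_carrier[OF assms] Pd(1)])
  show v: "v_gain Q \<in> carrier_mat r2 k"
    unfolding v_gain_def by (rule mult_carrier_mat[OF bottom_rows_carrier[OF assms] Pd(1)])
  show "input_gain Q \<in> carrier_mat k k"
    unfolding input_gain_def by (rule add_carrier_mat[OF mult_carrier_mat[OF P2 v]])
qed

lemma gain_linear:
  assumes Q: "Q \<in> carrier_mat (r1 + r2) k" and D: "D \<in> carrier_mat (r1 + r2) k"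
  shows "u_gain (Q + a \<cdot>\<^sub>m D) = u_gain Q + a \<cdot>\<^sub>m u_gain D"
    and "v_gain (Q + a \<cdot>\<^sub>m D) = v_gain Q + a \<cdot>\<^sub>m v_gain D"
    and "input_gain (Q + a \<cdot>\<^sub>m D) = input_gain Q + a \<cdot>\<^sub>m input_gain D"
proof -
  note d = carrier_matD[OF top_rows_carrier[OF Q]] carrier_matD[OF top_rows_carrier[OF D]]
    carrier_matD[OF bottom_rows_carrier[OF Q]] carrier_matD[OF bottom_rows_carrier[OF D]]
    carrier_matD[OF Pd(1)] carrier_matD[OF P1] carrier_matD[OF P2]
  show u: "u_gain (Q + a \<cdot>\<^sub>m D) = u_gain Q + a \<cdot>\<^sub>m u_gain D"
    unfolding u_gain_def top_rows_linear[OF Q D] using d by (simp add: mat_distribs)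
  show v: "v_gain (Q + a \<cdot>\<^sub>m D) = v_gain Q + a \<cdot>\<^sub>m v_gain D"
    unfolding v_gain_def top_rows_linear[OF Q D] using d by (simp add: mat_distribs)
  show "input_gain (Q + a \<cdot>\<^sub>m D) = input_gain Q + a \<cdot>\<^sub>m input_gain D"
    unfolding input_gain_def u v
    using d carrier_matD[OF gain_carrier(1)[OF Q]] carrier_matD[OF gain_carrier(2)[OF Q]]
      carrier_matD[OF gain_carrier(1)[OF D]] carrier_matD[OF gain_carrier(2)[OF D]]
    by (simp add: mat_distribs) (intro eq_matI, auto simp del: index_mult_mat(1) simp: algebra_simps)
qed

lemma expected_form_linear_right:
  assumes H: "H \<in> carrier_mat m m" "sym_mat H" and X: "X \<in> carrier_mat m k"
    and Y: "Y \<in> carrier_mat m k" and Z: "Z \<in> carrier_mat m k"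
  shows "expected_form H X (Y + a \<cdot>\<^sub>m Z) = expected_form H X Y + a * expected_form H X Z"
  using expected_form_add_left[OF H(1) Y smult_carrier_mat[OF Z] X]
    expected_form_smult_left[OF H(1) Z X] expected_form_commute[OF H X add_carrier_mat[OF smult_carrier_mat[OF Z]]]
    expected_form_commute[OF H X Y] expected_form_commute[OF H X Z]
  by simp

lemma expected_form_quadratic:
  assumes H: "H \<in> carrier_mat m m" "sym_mat H" and X: "X \<in> carrier_mat m k"
    and Y: "Y \<in> carrier_mat m k"
  shows "expected_form H (X + t \<cdot>\<^sub>m Y) (X + t \<cdot>\<^sub>m Y)
    = expected_form H X X + t * (2 * expected_form H X Y) + t\<^sup>2 * expected_form H Y Y"
proof -
  have XY: "X + t \<cdot>\<^sub>m Y \<in> carrier_mat m k"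
    using X Y by simp
  show ?thesis
    using expected_form_linear_right[OF H XY X Y, of t]
      expected_form_linear_right[OF H X X Y, of t] expected_form_linear_right[OF H Y X Y, of t]
      expected_form_commute[OF H XY X] expected_form_commute[OF H XY Y] expected_form_commute[OF H Y X]
    by (simp add: algebra_simps power2_eq_square)
qed

lemma cost_eq:
  assumes Q: "Q \<in> carrier_mat (r1 + r2) k"
  shows "cost Q = expected_form Mw (Pd + input_gain Q) (Pd + input_gain Q)
    + expected_form Rw (u_gain Q) (u_gain Q) + expected_form Vw (v_gain Q) (v_gain Q)"
proof -
  note g = gain_carrier[OF Q]
  have X: "Pd + input_gain Q \<in> carrier_mat k k"
    using g(3) by simp
  have traj: "trajectory n m1 m2 N A B1 B2 (u_gain Q *\<^sub>v W \<omega>) (v_gain Q *\<^sub>v W \<omega>) (W \<omega>)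
      = (Pd + input_gain Q) *\<^sub>v W \<omega>" if "\<omega> \<in> space \<Omega>" for \<omega>
  proof -
    note w = W_carrier[OF that]
    have P1u: "P1 * u_gain Q \<in> carrier_mat k k" and P2v: "P2 * v_gain Q \<in> carrier_mat k k"
      by (rule mult_carrier_mat[OF P1 g(1)] mult_carrier_mat[OF P2 g(2)])+
    have "(Pd + input_gain Q) *\<^sub>v W \<omega> = Pd *\<^sub>v W \<omega> + (P1 *\<^sub>v (u_gain Q *\<^sub>v W \<omega>) + P2 *\<^sub>v (v_gain Q *\<^sub>v W \<omega>))"
      unfolding input_gain_def
      by (simp only: add_mult_distrib_mat_vec[OF Pd(1) add_carrier_mat[OF P2v] w]
          add_mult_distrib_mat_vec[OF P1u P2v w] assoc_mult_mat_vec[OF P1 g(1) w]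
          assoc_mult_mat_vec[OF P2 g(2) w])
    also have "\<dots> = Pd *\<^sub>v W \<omega> + P1 *\<^sub>v (u_gain Q *\<^sub>v W \<omega>) + P2 *\<^sub>v (v_gain Q *\<^sub>v W \<omega>)"
      by (rule assoc_add_vec[OF mult_mat_vec_carrier[OF Pd(1) w]
          mult_mat_vec_carrier[OF P1 mult_mat_vec_carrier[OF g(1) w]]
          mult_mat_vec_carrier[OF P2 mult_mat_vec_carrier[OF g(2) w]], symmetric])
    also have "\<dots> = trajectory n m1 m2 N A B1 B2 (u_gain Q *\<^sub>v W \<omega>) (v_gain Q *\<^sub>v W \<omega>) (W \<omega>)"
      by (rule trajectory_eq[OF n A B1 B2 mult_mat_vec_carrier[OF g(1) w]
            mult_mat_vec_carrier[OF g(2) w] w, symmetric])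
    finally show ?thesis ..
  qed
  have "cost Q = (\<integral>\<omega>. ((Pd + input_gain Q) *\<^sub>v W \<omega>) \<bullet> (Mw *\<^sub>v ((Pd + input_gain Q) *\<^sub>v W \<omega>))
      + (u_gain Q *\<^sub>v W \<omega>) \<bullet> (Rw *\<^sub>v (u_gain Q *\<^sub>v W \<omega>))
      + (v_gain Q *\<^sub>v W \<omega>) \<bullet> (Vw *\<^sub>v (v_gain Q *\<^sub>v W \<omega>)) \<partial>\<Omega>)"
    unfolding feedforward_cost_def game_cost_def u_gain_def[symmetric] v_gain_def[symmetric]
    by (intro Bochner_Integration.integral_cong refl) (simp add: Let_def traj)
  then show ?thesis
    unfolding expected_form_def
    using integrable_form[OF Mw(1) X X] integrable_form[OF Rw(1) g(1) g(1)]
      integrable_form[OF Vw(1) g(2) g(2)]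
    by simp
qed

lemma cost_quadratic:
  assumes Q: "Q \<in> carrier_mat (r1 + r2) k" and D: "D \<in> carrier_mat (r1 + r2) k"
  shows "cost (Q + t \<cdot>\<^sub>m D) = cost Q + t * cost_gradient Q D + t\<^sup>2 * cost_hessian D D"
proof -
  note g = gain_carrier[OF Q] and h = gain_carrier[OF D]
  have QD: "Q + t \<cdot>\<^sub>m D \<in> carrier_mat (r1 + r2) k"
    using Q D by simp
  have X: "Pd + input_gain Q \<in> carrier_mat k k"
    using g(3) by simp
  have "Pd + (input_gain Q + t \<cdot>\<^sub>m input_gain D) = Pd + input_gain Q + t \<cdot>\<^sub>m input_gain D"
    by (rule assoc_add_mat[symmetric, OF Pd(1) g(3) smult_carrier_mat[OF h(3)]])
  then show ?thesis
    unfolding cost_eq[OF QD] cost_eq[OF Q] gain_linear[OF Q D] cost_gradient_def cost_hessian_def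
    by (simp only: expected_form_quadratic[OF Mw X h(3)] expected_form_quadratic[OF Rw g(1) h(1)]
        expected_form_quadratic[OF Vw g(2) h(2)]) (simp add: algebra_simps)
qed

lemma cost_gradient_linear:
  assumes Q: "Q \<in> carrier_mat (r1 + r2) k" and D: "D \<in> carrier_mat (r1 + r2) k"
    and E: "E \<in> carrier_mat (r1 + r2) k"
  shows "cost_gradient Q (D + a \<cdot>\<^sub>m E) = cost_gradient Q D + a * cost_gradient Q E"
proof -
  note g = gain_carrier[OF Q] and h = gain_carrier[OF D] and h' = gain_carrier[OF E]
  have X: "Pd + input_gain Q \<in> carrier_mat k k"
    using g(3) by simp
  show ?thesis
    unfolding gain_linear[OF D E] cost_gradient_def
    by (simp only: expected_form_linear_right[OF Mw X h(3) h'(3)]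
        expected_form_linear_right[OF Rw g(1) h(1) h'(1)]
        expected_form_linear_right[OF Vw g(2) h(2) h'(2)]) (simp add: algebra_simps)
qed

lemma cost_gradient_add:
  assumes "Q \<in> carrier_mat (r1 + r2) k" and "D \<in> carrier_mat (r1 + r2) k"
    and E: "E \<in> carrier_mat (r1 + r2) k"
  shows "cost_gradient Q (D + E) = cost_gradient Q D + cost_gradient Q E"
proof -
  have "1 \<cdot>\<^sub>m E = E"
    by (intro eq_matI) auto
  then show ?thesis
    using cost_gradient_linear[OF assms, of 1] by simp
qed

lemma cost_gradient_smult:
  assumes Q: "Q \<in> carrier_mat (r1 + r2) k" and D: "D \<in> carrier_mat (r1 + r2) k"
  shows "cost_gradient Q (a \<cdot>\<^sub>m D) = a * cost_gradient Q D"
proof -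
  have "D + (a - 1) \<cdot>\<^sub>m D = a \<cdot>\<^sub>m D"
    by (intro eq_matI) (auto simp: algebra_simps)
  then show ?thesis
    using cost_gradient_linear[OF Q D D, of "a - 1"] by (simp add: algebra_simps)
qed

text \<open>The gradient of a quadratic polynomial is affine in the base point. If it vanishes in
  direction \<open>E\<close> at both \<open>Q\<close> and \<open>Q + D\<close>, then
  \<open>cost_hessian D E = 0\<close>.\<close>

lemma cost_gradient_diff:
  assumes Q: "Q \<in> carrier_mat (r1 + r2) k" and D: "D \<in> carrier_mat (r1 + r2) k"
    and E: "E \<in> carrier_mat (r1 + r2) k"
  shows "cost_gradient (Q + D) E = cost_gradient Q E + 2 * cost_hessian D E"
proof -
  note g = gain_carrier[OF Q] and h = gain_carrier[OF D] and h' = gain_carrier[OF E]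
  have X: "Pd + input_gain Q \<in> carrier_mat k k"
    using g(3) by simp
  have one: "1 \<cdot>\<^sub>m Y = Y" for Y :: "real mat"
    by (intro eq_matI) auto
  have assoc: "Pd + (input_gain Q + input_gain D) = Pd + input_gain Q + input_gain D"
    by (rule assoc_add_mat[symmetric, OF Pd(1) g(3) h(3)])
  show ?thesis
    unfolding cost_gradient_def cost_hessian_def gain_linear[OF Q D, of 1, unfolded one] assoc
    by (simp only: expected_form_add_left[OF Mw(1) X h(3) h'(3)]
        expected_form_add_left[OF Rw(1) g(1) h(1) h'(1)]
        expected_form_add_left[OF Vw(1) g(2) h(2) h'(2)]) (simp add: algebra_simps)
qed

lemma cancel_Pd:
  assumes X: "X \<in> carrier_mat l k" and "X * Pd = 0\<^sub>m l k"
  shows "X = 0\<^sub>m l k"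
proof -
  let ?U = "1\<^sub>m k - block_shift n N * stack_A N A"
  have U: "?U \<in> carrier_mat k k"
    by (rule minus_carrier_mat[OF mult_carrier_mat[OF block_shift_carrier stack_A_carrier[OF A]]])
  have "X = X * (Pd * ?U)"
    unfolding Pd(3) using X by (intro right_mult_one_mat[symmetric])
  also have "\<dots> = (X * Pd) * ?U"
    by (rule assoc_mult_mat[symmetric, OF X Pd(1) U])
  also have "\<dots> = 0\<^sub>m l k"
    unfolding assms(2) using U by (rule left_mult_zero_mat)
  finally show ?thesis .
qed

text \<open>Flipping the sign of the second player's part of the direction turns the indefinite
  saddle form into the positive definite block matrix of the hypothesis, without its
  off-diagonal blocks.\<close>

lemma hessian_nondegenerate:
  assumes D1: "D1 \<in> carrier_mat r1 k" and D2: "D2 \<in> carrier_mat r2 k"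
    and zero: "cost_hessian (D1 @\<^sub>r D2) (D1 @\<^sub>r (- 1) \<cdot>\<^sub>m D2) = 0"
  shows "D1 = 0\<^sub>m r1 k" and "D2 = 0\<^sub>m r2 k"
proof -
  define u v where "u = D1 * Pd" and "v = D2 * Pd"
  have u: "u \<in> carrier_mat r1 k" and v: "v \<in> carrier_mat r2 k"
    unfolding u_def v_def by (rule mult_carrier_mat[OF D1 Pd(1)] mult_carrier_mat[OF D2 Pd(1)])+
  have mD2: "(- 1) \<cdot>\<^sub>m D2 \<in> carrier_mat r2 k"
    using D2 by simp
  have gains:
    "u_gain (D1 @\<^sub>r D2) = u" "v_gain (D1 @\<^sub>r D2) = v"
    "u_gain (D1 @\<^sub>r (- 1) \<cdot>\<^sub>m D2) = u" "v_gain (D1 @\<^sub>r (- 1) \<cdot>\<^sub>m D2) = (- 1) \<cdot>\<^sub>m v"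
    unfolding u_gain_def v_gain_def top_rows_append_rows[OF D1 D2] bottom_rows_append_rows[OF D1 D2]
      top_rows_append_rows[OF D1 mD2] bottom_rows_append_rows[OF D1 mD2] u_def v_def
    using D2 Pd(1) by (simp_all add: smult_mult_dim)
  define a b where "a = P1 * u" and "b = P2 * v"
  have a: "a \<in> carrier_mat k k" and b: "b \<in> carrier_mat k k"
    unfolding a_def b_def by (rule mult_carrier_mat[OF P1 u] mult_carrier_mat[OF P2 v])+
  have input: "input_gain (D1 @\<^sub>r D2) = a + b" "input_gain (D1 @\<^sub>r (- 1) \<cdot>\<^sub>m D2) = a + (- 1) \<cdot>\<^sub>m b"
    unfolding input_gain_def gains a_def b_def
    using P2 v by (simp_all add: mult_smult_dim)
  let ?H1 = "P1\<^sup>T * Mw * P1 + Rw" and ?H2 = "P2\<^sup>T * Mw * P2 + Vw"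
  have "P1\<^sup>T \<in> carrier_mat r1 k" and "P2\<^sup>T \<in> carrier_mat r2 k"
    using P1 P2 by simp_all
  note t1 = mult_carrier_mat[OF this(1) Mw(1)] and t2 = mult_carrier_mat[OF this(2) Mw(1)]
  note q1 = mult_carrier_mat[OF t1 P1] and q2 = mult_carrier_mat[OF t2 P2]
  note H1 = add_carrier_mat[OF Rw(1), of "P1\<^sup>T * Mw * P1"]
    and H2 = add_carrier_mat[OF Vw(1), of "P2\<^sup>T * Mw * P2"]
  from H2 have mH2: "- ?H2 \<in> carrier_mat r2 r2"
    by (rule uminus_carrier_mat)
  note pos = four_block_diagonal_pos[OF pos_def_cost H1 mult_carrier_mat[OF t1 P2]
      mult_carrier_mat[OF t2 P1] mH2]
  \<comment> \<open>The state parts are \<open>a + b\<close> and \<open>a - b\<close>; their cross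
    terms cancel by symmetry of \<open>Mw\<close>, and the two teams decouple.\<close>
  have "cost_hessian (D1 @\<^sub>r D2) (D1 @\<^sub>r (- 1) \<cdot>\<^sub>m D2)
      = expected_form Mw a a + expected_form Rw u u - (expected_form Mw b b + expected_form Vw v v)"
  proof -
    have ab: "a + b \<in> carrier_mat k k"
      using b by simp
    have vz: "expected_form Vw v ((- 1) \<cdot>\<^sub>m v) = - expected_form Vw v v"
      using expected_form_commute[OF Vw v smult_carrier_mat[OF v]] expected_form_smult_left[OF Vw(1) v v]
      by simp
    show ?thesis
      using expected_form_linear_right[OF Mw ab a b, of "- 1"] expected_form_add_left[OF Mw(1) a b a]
        expected_form_add_left[OF Mw(1) a b b] expected_form_commute[OF Mw a b]
      unfolding cost_hessian_def input gains vz by linarith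
  qed
  also have "expected_form Mw a a + expected_form Rw u u = expected_form ?H1 u u"
    using expected_form_pullback[OF Mw(1) P1 u u] expected_form_add_weight[OF q1 Rw(1) u u]
    unfolding a_def by linarith
  also have "expected_form Mw b b + expected_form Vw v v = expected_form ?H2 v v"
    using expected_form_pullback[OF Mw(1) P2 v v] expected_form_add_weight[OF q2 Vw(1) v v]
    unfolding b_def by linarith
  also have "expected_form ?H2 v v = - expected_form (- ?H2) v v"
    using expected_form_uminus_weight[OF H2 v v] by linarith
  finally have "expected_form ?H1 u u + expected_form (- ?H2) v v = 0"
    using zero by simp
  then have "expected_form ?H1 u u = 0" "expected_form (- ?H2) v v = 0"
    using expected_form_nonneg(1)[OF H1 u pos(1)] expected_form_nonneg(1)[OF mH2 v pos(2)] by linarith+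
  then have "u = 0\<^sub>m r1 k" "v = 0\<^sub>m r2 k"
    using expected_form_nonneg(2)[OF H1 u pos(1)] expected_form_nonneg(2)[OF mH2 v pos(2)] by blast+
  then show "D1 = 0\<^sub>m r1 k" "D2 = 0\<^sub>m r2 k"
    unfolding u_def v_def using cancel_Pd[OF D1] cancel_Pd[OF D2] by blast+
qed

section \<open>Critical points and saddle points\<close>

abbreviation "P \<equiv> P_inputs n m1 m2 N A B1 B2"

text \<open>Here the cost itself is quadratic along every line, so the single-entry directions serve
  only to separate the teams before linearity joins them.\<close>

lemma feedforward_saddle_critical:
  assumes S1: "S1 \<in> carrier_mat r1 k" and S2: "S2 \<in> carrier_mat r2 k"
    and saddle: "saddle_point S1 S2 cost Q1 Q2" and E: "E \<in> gains (S1 @\<^sub>r S2)"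
  shows "cost_gradient (Q1 @\<^sub>r Q2) E = 0"
proof -
  have Q: "Q1 @\<^sub>r Q2 \<in> carrier_mat (r1 + r2) k"
    using saddle gains_carrier[OF S1] gains_carrier[OF S2]
    by (intro carrier_append_rows) (auto simp: saddle_point_def)
  show ?thesis
  proof (rule linear_zero_on_gains[OF _ _ carrier_append_rows[OF S1 S2] _ E])
    fix i j assume ij: "i < r1 + r2" "j < k" "(S1 @\<^sub>r S2) $$ (i, j) \<noteq> 0"
    let ?D = "unit_mat (r1 + r2) k i j"
    have "cost ((Q1 @\<^sub>r Q2) + t \<cdot>\<^sub>m ?D)
        = cost (Q1 @\<^sub>r Q2) + t * cost_gradient (Q1 @\<^sub>r Q2) ?D + t\<^sup>2 * cost_hessian ?D ?D" for t
      by (rule cost_quadratic[OF Q unit_mat_carrier])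
    with saddle_point_unit_extremum[OF saddle S1 S2 ij]
    show "cost_gradient (Q1 @\<^sub>r Q2) ?D = 0"
      by (intro quadratic_extremum[where b = "cost_hessian ?D ?D"]) (simp add: algebra_simps)
  qed (rule cost_gradient_add[OF Q] cost_gradient_smult[OF Q]; assumption)+
qed

lemma feedback_saddle_eq:
  assumes info1: "info_structure n m1 N S1" and info2: "info_structure n m2 N S2"
    and causal1: "causal n m1 N S1" and causal2: "causal n m2 N S2"
    and mqi: "mutually_quadratically_invariant S1 S2 P"
    and feedforward: "saddle_point S1 S2 cost Q1 Q2"
    and feedback: "saddle_point S1 S2 (feedback_cost \<Omega> W n m1 m2 N A B1 B2 M R V) K1 K2"
  shows "K1 @\<^sub>r K2 = g_map P (Q1 @\<^sub>r Q2)"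
proof -
  have S1: "S1 \<in> carrier_mat r1 k" and S2: "S2 \<in> carrier_mat r2 k"
    using info1 info2 by (auto simp: info_structure_def)
  note S = carrier_append_rows[OF S1 S2]
  note P = P_inputs_carrier[OF n A B1 B2, of N]
  have qi: "K * P * K \<in> gains (S1 @\<^sub>r S2)" if "K \<in> gains (S1 @\<^sub>r S2)" for K
    using mqi that unfolding mutually_quadratically_invariant_def stacked_gains_eq[OF S1 S2] by blast
  have PK: "P * K \<in> carrier_mat k k" if "K \<in> gains (S1 @\<^sub>r S2)" for K
    by (rule mult_carrier_mat[OF P gains_carrier[OF S that]])
  have lower: "strictly_lower (P * K)" if "K \<in> gains (S1 @\<^sub>r S2)" for K
    using strictly_lower_closed_loop[OF n A B1 B2 info1 causal1 info2 causal2] that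
    by (simp add: stacked_gains_eq[OF S1 S2])
  have regular: "\<exists>T \<in> carrier_mat k k. (1\<^sub>m k - P * K) * T = 1\<^sub>m k"
    if K: "K \<in> gains (S1 @\<^sub>r S2)" for K
  proof -
    have "det (1\<^sub>m k - P * K) \<noteq> 0"
      unfolding det_one_minus_strictly_lower[OF PK[OF K] lower[OF K]] by simp
    note invertible_mat_inv[OF minus_carrier_mat[OF PK[OF K]] this]
    from this(2,1) show ?thesis
      by (rule bexI)
  qed
  define K where "K = K1 @\<^sub>r K2"
  define Q where "Q = Q1 @\<^sub>r Q2"
  have Kg: "K \<in> gains (S1 @\<^sub>r S2)" and Qg: "Q \<in> gains (S1 @\<^sub>r S2)"
    using feedback feedforward unfolding K_def Q_def stacked_gains_eq[OF S1 S2, symmetric]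
    by (auto simp: saddle_point_def stacked_gains_def)
  obtain T where T: "T \<in> carrier_mat k k" "(1\<^sub>m k - P * K) * T = 1\<^sub>m k"
    using regular[OF Kg] by blast
  define Q' where "Q' = g_inv P K"
  \<comment> \<open>Membership matters because the difference of \<open>Q'\<close> and
    \<open>Q\<close> has to yield an admissible test direction.\<close>
  have Q'g: "Q' \<in> gains (S1 @\<^sub>r S2)"
    unfolding Q'_def
    by (rule g_inv_in_gains[OF S P qi Kg T strictly_lower_nilpotent[OF PK[OF Kg] lower[OF Kg]]])
  have crit': "cost_gradient Q' E = 0" if E: "E \<in> gains (S1 @\<^sub>r S2)" for E
    unfolding Q'_def
  proof (rule feedback_extremum_critical[OF S P qi regular _ _ _ Kg _ E, where F = cost
        and G = "\<lambda>D. cost_hessian D D"])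
    fix i j assume "i < r1 + r2" "j < k" "(S1 @\<^sub>r S2) $$ (i, j) \<noteq> 0"
    from saddle_point_unit_extremum[OF feedback S1 S2 this]
    show "(\<forall>t. cost (g_inv P K) \<le> cost (g_inv P (K + t \<cdot>\<^sub>m unit_mat (r1 + r2) k i j))) \<or>
        (\<forall>t. cost (g_inv P (K + t \<cdot>\<^sub>m unit_mat (r1 + r2) k i j)) \<le> cost (g_inv P K))"
      by (simp add: feedback_cost_def K_def)
  qed (assumption | rule cost_quadratic cost_gradient_add cost_gradient_smult)+
  have "Q' - Q \<in> stacked_gains S1 S2"
    using Q'g Qg by (simp add: stacked_gains_eq[OF S1 S2] gains_minus)
  then obtain D1 D2 where D: "Q' - Q = D1 @\<^sub>r D2" "D1 \<in> gains S1" "D2 \<in> gains S2"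
    by (auto simp: stacked_gains_def)
  note D1 = gains_carrier[OF S1 D(2)] and D2 = gains_carrier[OF S2 D(3)]
  \<comment> \<open>The sign flip stays admissible since the structure is a product of two
    subspaces.\<close>
  define E where "E = D1 @\<^sub>r (- 1) \<cdot>\<^sub>m D2"
  have Eg: "E \<in> gains (S1 @\<^sub>r S2)"
    using D gains_smult[OF D(3), of "- 1"]
    unfolding E_def stacked_gains_eq[OF S1 S2, symmetric] stacked_gains_def by blast
  note Qc = gains_carrier[OF S Qg] and Q'c = gains_carrier[OF S Q'g] and Ec = gains_carrier[OF S Eg]
  have Q'_eq: "Q' = Q + (D1 @\<^sub>r D2)"
    unfolding D(1)[symmetric] using Qc Q'c by (intro eq_matI) auto
  \<comment> \<open>The gradients at \<open>Q'\<close> and at \<open>Q\<close> both vanish in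
    direction \<open>E\<close>, and they differ by twice this value.\<close>
  have "cost_hessian (D1 @\<^sub>r D2) E = 0"
    using cost_gradient_diff[OF Qc carrier_append_rows[OF D1 D2] Ec] crit'[OF Eg]
      feedforward_saddle_critical[OF S1 S2 feedforward Eg]
    by (simp add: Q'_eq Q_def)
  then have "D1 = 0\<^sub>m r1 k" "D2 = 0\<^sub>m r2 k"
    unfolding E_def using hessian_nondegenerate[OF D1 D2] by blast+
  then have "Q' = Q"
    unfolding Q'_eq using Qc by (intro eq_matI) (auto simp: append_rows_def)
  then show ?thesis
    using g_map_g_inv[OF P gains_carrier[OF S Kg] T] by (simp add: Q'_def Q_def K_def)
qed

end

theorem theorem2:
  fixes n m1 m2 N :: nat
    and A B1 B2 \<Sigma> :: "real mat"
    and M R V :: "nat \<Rightarrow> real mat"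
    and \<Omega> :: "'w measure" and W :: "'w \<Rightarrow> real Matrix.vec"
    and S1 S2 :: "nat mat"
    and Q1 Q2 :: "real mat"
  assumes "n > 0" and "m1 > 0" and "m2 > 0" and "N > 0"
    and "A \<in> carrier_mat n n" and "B1 \<in> carrier_mat n m1" and "B2 \<in> carrier_mat n m2"
    and "\<And>t. t \<in> {1..N} \<Longrightarrow> M t \<in> carrier_mat n n \<and> sym_mat (M t)"
    and "\<And>t. t < N \<Longrightarrow> R t \<in> carrier_mat m1 m1 \<and> sym_mat (R t)"
    and "\<And>t. t < N \<Longrightarrow> V t \<in> carrier_mat m2 m2 \<and> sym_mat (V t)"
    and "prob_space \<Omega>"
    and "gaussian_vec \<Omega> (n * (N + 1)) W"
    and "mean_vec \<Omega> (n * (N + 1)) W = 0\<^sub>v (n * (N + 1))"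
    and "cov_mat \<Omega> (n * (N + 1)) W = \<Sigma>" and "pos_def_mat \<Sigma>"
    and "info_structure n m1 N S1" and "info_structure n m2 N S2"
    and "causal n m1 N S1" and "causal n m2 N S2"
    and "mutually_quadratically_invariant S1 S2 (P_inputs n m1 m2 N A B1 B2)"
    and "pos_def_mat (four_block_mat
           ((P_input n m1 N A B1)\<^sup>T * stack_M n N M * P_input n m1 N A B1 + stack_input_weight N R)
           ((P_input n m1 N A B1)\<^sup>T * stack_M n N M * P_input n m2 N A B2)
           ((P_input n m2 N A B2)\<^sup>T * stack_M n N M * P_input n m1 N A B1)
           (- ((P_input n m2 N A B2)\<^sup>T * stack_M n N M * P_input n m2 N A B2
               + stack_input_weight N V)))"
    and "saddle_point S1 S2 (feedforward_cost \<Omega> W n m1 m2 N A B1 B2 M R V) Q1 Q2"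
  shows "(\<exists>K1 K2. saddle_point S1 S2 (feedback_cost \<Omega> W n m1 m2 N A B1 B2 M R V) K1 K2)
         \<longrightarrow>
         (\<exists>K1 K2. saddle_point S1 S2 (feedback_cost \<Omega> W n m1 m2 N A B1 B2 M R V) K1 K2
          \<and> (\<forall>L1 L2. saddle_point S1 S2 (feedback_cost \<Omega> W n m1 m2 N A B1 B2 M R V) L1 L2
                \<longrightarrow> L1 = K1 \<and> L2 = K2)
          \<and> K1 @\<^sub>r K2 = g_map (P_inputs n m1 m2 N A B1 B2) (Q1 @\<^sub>r Q2))"
proof
  interpret prob_space \<Omega> by fact
  interpret team_game \<Omega> n N W \<Sigma> m1 m2 A B1 B2 M R V
    using assms by unfold_locales
  let ?saddle = "saddle_point S1 S2 (feedback_cost \<Omega> W n m1 m2 N A B1 B2 M R V)"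
  have eq: "K1 @\<^sub>r K2 = g_map P (Q1 @\<^sub>r Q2)" if "?saddle K1 K2" for K1 K2
    by (rule feedback_saddle_eq[OF assms(16-20) assms(22) that])
  \<comment> \<open>The stacked gain is determined by \<open>Q1\<close> and \<open>Q2\<close> alone,
    and the number of rows of \<open>S1\<close> fixes where it is cut, so both blocks agree.\<close>
  have inj: "L1 = K1 \<and> L2 = K2" if K: "?saddle K1 K2" and L: "?saddle L1 L2" for K1 K2 L1 L2
  proof -
    have S1: "S1 \<in> carrier_mat (m1 * N) k" and S2: "S2 \<in> carrier_mat (m2 * N) k"
      using assms(16,17) by (auto simp: info_structure_def)
    have car: "K1 \<in> carrier_mat (m1 * N) k" "K2 \<in> carrier_mat (m2 * N) k"
      "L1 \<in> carrier_mat (m1 * N) k" "L2 \<in> carrier_mat (m2 * N) k"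
      using K L gains_carrier[OF S1] gains_carrier[OF S2] by (auto simp: saddle_point_def)
    have "L1 @\<^sub>r L2 = K1 @\<^sub>r K2"
      using eq[OF K] eq[OF L] by simp
    then show ?thesis
      using top_rows_append_rows[OF car(1,2)] top_rows_append_rows[OF car(3,4)]
        bottom_rows_append_rows[OF car(1,2)] bottom_rows_append_rows[OF car(3,4)] by simp
  qed
  assume "\<exists>K1 K2. ?saddle K1 K2"
  then show "\<exists>K1 K2. ?saddle K1 K2 \<and> (\<forall>L1 L2. ?saddle L1 L2 \<longrightarrow> L1 = K1 \<and> L2 = K2)
      \<and> K1 @\<^sub>r K2 = g_map P (Q1 @\<^sub>r Q2)"
    using eq inj by blast
qed

end
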